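(* Let $m,n$ be positive integers with $m\equiv 1\pmod 4$ or $m\equiv 4\pmod 8$. Suppose there is an odd prime divisor $p$ of $m$ such that the Legendre symbol $\left(\frac{4n+5}p\right)=-1$. Then $$t(1,1,8,m;n)=\frac 12N(1,1,8,m;8n+10+m).$$
   Context: For positive integers $a_1,\dots,a_k$ and a nonnegative integer $n$, $N(a_1,\dots,a_k;n)$ is the number of $(x_1,\dots,x_k)\in\mathbb Z^k$ with $n=a_1x_1^2+\cdots+a_kx_k^2$, and $t(a_1,\dots,a_k;n)$ is the number of $(x_1,\dots,x_k)\in\mathbb Z^k$ with $n=a_1\frac{x_1(x_1-1)}2+\cdots+a_k\frac{x_k(x_k-1)}2$. *)

theory Defs
  imports "HOL-Number_Theory.Number_Theory"
begin

text \<open>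
  A tuple in \<open>\<int>\<^sup>k\<close> is an integer list of length \<open>k\<close>. When all entries of \<open>as\<close> are positive,
  both solution sets below are finite, so that \<open>card\<close> is the true number of solutions.
\<close>

definition N :: "nat list \<Rightarrow> nat \<Rightarrow> nat" where
  "N as n = card {xs :: int list. length xs = length as \<and>
     int n = (\<Sum>i<length as. int (as ! i) * (xs ! i)\<^sup>2)}"

text \<open>The integer division below is exact, since \<open>x * (x - 1)\<close> is always even.\<close>

definition t :: "nat list \<Rightarrow> nat \<Rightarrow> nat" where
  "t as n = card {xs :: int list. length xs = length as \<and>
     int n = (\<Sum>i<length as. int (as ! i) * ((xs ! i) * (xs ! i - 1) div 2))}"

end

theory Submission
  imports Defs
begin

text \<open>
  Putting \<open>x \<mapsto> 2 x - 1\<close>, the left side counts the solutions of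
  \<open>x\<^sup>2 + y\<^sup>2 + 8 z\<^sup>2 + m w\<^sup>2 = 8 n + 10 + m\<close> with all entries odd. In every solution \<open>x, y, w\<close> are odd, so the
  claim is that \<open>(-1)\<^sup>z\<close> sums to \<open>0\<close> over all solutions. For fixed \<open>w\<close>, writing \<open>x = u + v\<close>, \<open>y = u - v\<close>, this is
  the sum of \<open>(-1)\<^sup>z\<close> over \<open>u\<^sup>2 + v\<^sup>2 + 4 z\<^sup>2 = K\<close> where \<open>K \<equiv> 1 (mod 4)\<close> and \<open>K \<equiv> 4 n + 5 (mod p)\<close>; in
  particular \<open>K\<close> is not a square.

  That this sum vanishes for nonsquare \<open>K\<close> is a form of Jacobi's identity for the cube of the eta function.
  The proof is by Liouville-style involutions. With \<open>\<chi>\<close> the nontrivial character mod 4, the signed sums of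
  \<open>\<chi>(d)\<close> over \<open>4 z\<^sup>2 + d e = K\<close> and over \<open>u\<^sup>2 + 8 d e = K\<close> are evaluated explicitly: they vanish unless \<open>K\<close> is
  a square. Comparing them with the corresponding sums over \<open>x\<^sup>2 + y\<^sup>2 + 4 z\<^sup>2 = K\<close> and
  \<open>u\<^sup>2 + 8 (c\<^sup>2 + d\<^sup>2) = K\<close> yields, by induction on \<open>n\<close>, that \<open>n\<close> has \<open>4 \<Sum>\<^sub>d\<^sub>|\<^sub>n \<chi>(d)\<close> representations as a sum
  of two squares, and then the vanishing.
\<close>

section \<open>The character mod 4, the sign \<open>eps\<close>, and elementary tools\<close>

definition chi :: "int \<Rightarrow> int" where
  "chi x = (if x mod 4 = 1 then 1 else if x mod 4 = 3 then -1 else 0)"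

definition eps :: "int \<Rightarrow> int" where
  "eps x = (if even x then 1 else -1)"

lemma eps_add: "eps (a + b) = eps a * eps b"
  by (auto simp: eps_def)

lemma eps_diff: "eps (a - b) = eps a * eps b"
  by (auto simp: eps_def)

lemma eps_minus [simp]: "eps (- a) = eps a"
  by (auto simp: eps_def)

lemma chi_minus [simp]: "chi (- x) = - chi x"
proof -
  have "x mod 4 = 0 \<or> x mod 4 = 1 \<or> x mod 4 = 2 \<or> x mod 4 = 3" by presburger
  moreover have "(- x) mod 4 = (- (x mod 4)) mod 4" by (simp add: mod_minus_eq)
  ultimately show ?thesis by (auto simp: chi_def)
qed

lemma chi_even: "even x \<Longrightarrow> chi x = 0"
  unfolding chi_def by presburger

lemma chi_add_double:
  assumes "odd x"
  shows "chi (x + 2 * y) = eps y * chi x"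
proof -
  have "x mod 4 = 1 \<or> x mod 4 = 3" using assms by presburger
  moreover have "even y \<Longrightarrow> (x + 2 * y) mod 4 = x mod 4" by presburger
  moreover have "odd y \<Longrightarrow> (x + 2 * y) mod 4 = (x + 2) mod 4" by presburger
  moreover have "x mod 4 = 1 \<Longrightarrow> (x + 2) mod 4 = 3" by presburger
  moreover have "x mod 4 = 3 \<Longrightarrow> (x + 2) mod 4 = 1" by presburger
  ultimately show ?thesis by (auto simp: chi_def eps_def)
qed

lemma chi_diff_double: "odd x \<Longrightarrow> chi (x - 2 * y) = eps y * chi x"
  using chi_add_double[of x "-y"] by simp

lemma chi_cong: "x mod 4 = y mod 4 \<Longrightarrow> chi x = chi y"
  by (simp add: chi_def)

text \<open>Fixed points of \<open>g\<close> are allowed: the weight vanishes there, because it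
  equals its own negative.\<close>

lemma sum_involution_0:
  fixes f :: "'a \<Rightarrow> int"
  assumes "\<And>x. x \<in> A \<Longrightarrow> g x \<in> A" "\<And>x. x \<in> A \<Longrightarrow> g (g x) = x"
    and "\<And>x. x \<in> A \<Longrightarrow> f (g x) = - f x"
  shows "sum f A = 0"
proof -
  have "sum f A = sum (\<lambda>x. - f x) A"
    by (rule sum.reindex_bij_witness[of _ g g]) (use assms in auto)
  thus ?thesis by (simp add: sum_negf)
qed

lemma odd_sq_mod8: "odd (x::int) \<Longrightarrow> x\<^sup>2 mod 8 = 1"
proof -
  assume "odd x"
  then obtain k where k: "x = 2 * k + 1" by (elim oddE)
  have "even (k * (k + 1))" by simp
  then obtain j where j: "k * (k + 1) = 2 * j" by (elim evenE)
  have "x\<^sup>2 = 4 * (k * (k + 1)) + 1" by (simp add: k power2_eq_square algebra_simps)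
  thus ?thesis by (simp add: j)
qed

lemma sq_le_imp_mem_interval:
  fixes x K :: int
  assumes "x\<^sup>2 \<le> K"
  shows "x \<in> {-K..K}"
proof -
  have "\<bar>x\<bar> * 1 \<le> \<bar>x\<bar> * \<bar>x\<bar>" by (cases "x = 0") (auto intro!: mult_left_mono simp del: abs_mult_self_eq)
  also have "\<dots> = x\<^sup>2" by (simp add: power2_eq_square)
  finally show ?thesis using assms by auto
qed

lemma pos_mult_le_imp:
  fixes a b K :: int
  assumes "a > 0" "b > 0" "a * b \<le> K"
  shows "a \<in> {0..K}" "b \<in> {0..K}"
proof -
  have "a * 1 \<le> a * b" "1 * b \<le> a * b"
    using assms by (intro mult_left_mono mult_right_mono; simp)+
  hence "a \<le> K" "b \<le> K" using assms(3) by linarith+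
  thus "a \<in> {0..K}" "b \<in> {0..K}" using assms by auto
qed

subsection \<open>Solutions of $p^2 + 4ab = K$\<close>

definition pos_forms :: "int \<Rightarrow> (int \<times> int \<times> int) set" where
  "pos_forms K = {(p, a, b). a > 0 \<and> b > 0 \<and> p\<^sup>2 + 4 * a * b = K}"

lemma finite_pos_forms: "finite (pos_forms K)"
proof (rule finite_subset)
  show "pos_forms K \<subseteq> {-K..K} \<times> {0..K} \<times> {0..K}"
  proof (rule subsetI, clarsimp simp only: mem_Sigma_iff split_paired_all)
    fix p a b assume "(p, a, b) \<in> pos_forms K"
    hence h: "a > 0" "b > 0" "p\<^sup>2 + 4 * (a * b) = K" by (auto simp: pos_forms_def)
    have "a * b > 0" using h by simp
    moreover have "p\<^sup>2 \<ge> 0" by simp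
    ultimately have "p\<^sup>2 \<le> K" "a * b \<le> K" using h by linarith+
    thus "p \<in> {-K..K} \<and> a \<in> {0..K} \<and> b \<in> {0..K}"
      using sq_le_imp_mem_interval pos_mult_le_imp h by blast
  qed
qed auto

lemma pos_forms_odd: "(p, a, b) \<in> pos_forms K \<Longrightarrow> odd K \<Longrightarrow> odd p"
  by (auto simp: pos_forms_def)

lemma pos_forms_mod8:
  assumes "(p, a, b) \<in> pos_forms K" "odd K"
  shows "K mod 8 = (if even (a * b) then 1 else 5)"
proof -
  have p: "p\<^sup>2 mod 8 = 1" using pos_forms_odd odd_sq_mod8 assms by blast
  have K: "K = p\<^sup>2 + 4 * (a * b)" using assms by (simp add: pos_forms_def)
  show ?thesis
  proof (cases "even (a * b)")
    case True
    then obtain c where "a * b = 2 * c" by (elim evenE)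
    hence "K = p\<^sup>2 + 8 * c" using K by simp
    thus ?thesis using p True by simp
  next
    case False
    then obtain c where "a * b = 2 * c + 1" by (elim oddE)
    hence "K = p\<^sup>2 + 8 * c + 4" using K by simp
    hence "K mod 8 = 5" using p by presburger
    thus ?thesis using False by simp
  qed
qed

lemma sum_pos_forms_flip:
  "(\<Sum>(p, a, b)\<in>pos_forms K. g p a b * chi p) = - (\<Sum>(p, a, b)\<in>pos_forms K. g (- p) a b * chi p)"
  unfolding sum_negf[symmetric]
  by (rule sum.reindex_bij_witness[of _ "\<lambda>(p, a, b). (- p, a, b)" "\<lambda>(p, a, b). (- p, a, b)"])
    (auto simp: pos_forms_def)

text \<open>The map \<open>p \<mapsto> - p\<close> preserves the solutions and \<open>chi\<close> is
  odd. Later proofs therefore show that two weights have equal sums by checking that their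
  difference is even in \<open>p\<close>.\<close>

lemma sum_pos_forms_sym_0:
  assumes "\<And>p a b. (p, a, b) \<in> pos_forms K \<Longrightarrow> g (- p) a b = g p a b"
  shows "(\<Sum>(p, a, b)\<in>pos_forms K. g p a b * chi p) = 0"
proof -
  have "(\<Sum>(p, a, b)\<in>pos_forms K. g (- p) a b * chi p) = (\<Sum>(p, a, b)\<in>pos_forms K. g p a b * chi p)"
    by (rule sum.cong) (auto simp: assms)
  thus ?thesis using sum_pos_forms_flip[of g K] by simp
qed

text \<open>The map \<open>(p, a, b) \<mapsto> (2 * b - p, p + a - b, b)\<close> preserves
  \<open>p\<^sup>2 + 4 * a * b\<close>, and \<open>p > b - a\<close> says exactly that the new
  middle entry is positive. For even \<open>b\<close> it negates \<open>chi p\<close>.\<close>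

lemma sum_pos_forms_even_region:
  assumes "odd K"
  shows "(\<Sum>(p, a, b)\<in>pos_forms K. of_bool (even b \<and> p > b - a) * chi p) = 0"
proof -
  have "(\<Sum>(p, a, b)\<in>pos_forms K. of_bool (even b \<and> p > b - a) * chi p) =
      (\<Sum>(p, a, b) \<in> {(p, a, b) \<in> pos_forms K. even b \<and> p > b - a}. chi p)"
    by (rule sum.mono_neutral_cong_right) (auto simp: finite_pos_forms)
  also have "\<dots> = 0"
  proof (rule sum_involution_0[where g = "\<lambda>(p, a, b). (2 * b - p, p + a - b, b)"])
    fix x assume "x \<in> {(p, a, b) \<in> pos_forms K. even b \<and> p > b - a}"
    then obtain p a b where x: "x = (p, a, b)" and h: "(p, a, b) \<in> pos_forms K" "even b" "p > b - a" by auto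
    have "odd p" using h assms pos_forms_odd by blast
    show "(case x of (p, a, b) \<Rightarrow> (2 * b - p, p + a - b, b)) \<in> {(p, a, b) \<in> pos_forms K. even b \<and> p > b - a}"
      using h by (auto simp: x pos_forms_def power2_eq_square algebra_simps)
    show "(case case x of (p, a, b) \<Rightarrow> (2 * b - p, p + a - b, b) of
        (p, a, b) \<Rightarrow> (2 * b - p, p + a - b, b)) = x"
      by (simp add: x)
    have "chi (2 * b - p) = - chi (p - 2 * b)" using chi_minus[of "p - 2 * b"] by simp
    also have "\<dots> = - chi p" using chi_diff_double[OF \<open>odd p\<close>, of b] h by (simp add: eps_def)
    finally show "(case case x of (p, a, b) \<Rightarrow> (2 * b - p, p + a - b, b) of (p, a, b) \<Rightarrow> chi p) =
        - (case x of (p, a, b) \<Rightarrow> chi p)" by (simp add: x)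
  qed
  finally show ?thesis .
qed

text \<open>
  The case split \<open>p > a - b\<close> against \<open>p > b - a\<close> is invariant under \<open>p \<mapsto> - p\<close> except on the
  diagonal \<open>p = \<plusminus> (a - b)\<close>, where \<open>K = (a + b)\<^sup>2\<close>.
\<close>

lemma sum_pos_forms_pos_neg_mod8_1:
  assumes "odd K"
  shows "(\<Sum>(p, a, b)\<in>pos_forms K. of_bool (even a \<and> even b \<and> p > \<bar>a - b\<bar>) * chi p) +
         (\<Sum>(p, a, b)\<in>pos_forms K. of_bool (odd a \<and> even b \<and> p > a - b) * chi p) =
         (\<Sum>(p, a, b)\<in>pos_forms K. of_bool (odd a \<and> even b \<and> p = b - a) * chi p)"
    (is "?X + ?Y = ?Z")
proof -
  define S where "S g = (\<Sum>(p, a, b)\<in>pos_forms K. g p a b * chi p)" for g :: "int \<Rightarrow> int \<Rightarrow> int \<Rightarrow> int"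
  have S_add: "S g + S h = S (\<lambda>p a b. g p a b + h p a b)" for g h
    unfolding S_def by (simp add: sum.distrib[symmetric] case_prod_unfold algebra_simps)
  have S_diff: "S g - S h = S (\<lambda>p a b. g p a b - h p a b)" for g h
    unfolding S_def by (simp add: sum_subtractf[symmetric] case_prod_unfold algebra_simps)
  have S_cong: "S g = S h" if "\<And>p a b. odd p \<Longrightarrow> g p a b = h p a b" for g h
    unfolding S_def using pos_forms_odd[OF _ assms] that by (intro sum.cong) auto
  have S_flip: "S g = - S (\<lambda>p. g (- p))" for g
    unfolding S_def by (rule sum_pos_forms_flip)
  \<comment> \<open>For even \<open>a\<close> and \<open>b\<close> an odd \<open>p\<close> never
    equals \<open>a - b\<close> or \<open>b - a\<close>, so the difference of the two indicators is
    even in \<open>p\<close>.\<close>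
  have X: "?X - S (\<lambda>p a b. of_bool (even a \<and> even b \<and> p > b - a)) = 0"
    unfolding S_def[symmetric] S_diff unfolding S_def
  proof (rule sum_pos_forms_sym_0)
    fix p a b assume "(p, a, b) \<in> pos_forms K"
    hence "odd p" using pos_forms_odd assms by blast
    hence "even a \<and> even b \<Longrightarrow> p \<noteq> a - b \<and> p \<noteq> b - a" by auto
    thus "of_bool (even a \<and> even b \<and> - p > \<bar>a - b\<bar>) - of_bool (even a \<and> even b \<and> - p > b - a) =
        (of_bool (even a \<and> even b \<and> p > \<bar>a - b\<bar>) - of_bool (even a \<and> even b \<and> p > b - a) :: int)"
      by (cases "even a \<and> even b") (auto simp: of_bool_def abs_if)
  qed
  have E: "S (\<lambda>p a b. of_bool (even a \<and> even b \<and> p > b - a)) +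
        S (\<lambda>p a b. of_bool (odd a \<and> even b \<and> p > b - a)) = 0"
    unfolding S_add using sum_pos_forms_even_region[OF assms]
    unfolding S_def[symmetric] by (rule trans[rotated]) (rule S_cong, auto)
  define g :: "int \<Rightarrow> int \<Rightarrow> int \<Rightarrow> int" where "g p a b = of_bool (odd a \<and> even b \<and> p > a - b) - of_bool (odd a \<and> even b \<and> p > b - a)" for p a b
  define z :: "int \<Rightarrow> int \<Rightarrow> int \<Rightarrow> int" where "z p a b = of_bool (odd a \<and> even b \<and> p = b - a)" for p a b
  have XY: "?X + ?Y = S g"
    using X E S_diff[of "\<lambda>p a b. of_bool (odd a \<and> even b \<and> p > a - b)" "\<lambda>p a b. of_bool (odd a \<and> even b \<and> p > b - a)"]
    unfolding g_def S_def[symmetric] by linarith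
  have "2 * S g = S g - S (\<lambda>p. g (- p))" using S_flip[of g] by simp
  \<comment> \<open>By trichotomy \<open>p > c\<close> and \<open>p < c\<close> together miss only
    \<open>p = c\<close>. With \<open>c = a - b\<close> and \<open>c = b - a\<close> the
    inequalities cancel and only the two diagonals remain.\<close>
  also have "\<dots> = S z - S (\<lambda>p. z (- p))"
    unfolding S_diff by (rule S_cong) (auto simp: g_def z_def of_bool_def)
  also have "\<dots> = 2 * S z" using S_flip[of z] by simp
  finally have "S g = S z" by simp
  thus ?thesis using XY unfolding z_def S_def by simp
qed

text \<open>Here \<open>a\<close> and \<open>b\<close> are odd, so the odd number \<open>p\<close>
  avoids the even numbers \<open>a - b\<close> and \<open>b - a\<close>. No diagonal term arises and
  the difference of the indicators is even in \<open>p\<close>.\<close>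

lemma sum_pos_forms_pos_neg_mod8_5:
  assumes "K mod 8 = 5"
  shows "(\<Sum>(p, a, b)\<in>pos_forms K. of_bool (p > a - b) * chi p) =
         (\<Sum>(p, a, b)\<in>pos_forms K. of_bool (p > \<bar>a - b\<bar>) * chi p)"
proof -
  have "odd K" using assms by presburger
  hence "odd a \<and> odd b" if "(p, a, b) \<in> pos_forms K" for p a b
    using pos_forms_mod8[OF that] assms by (auto split: if_splits)
  moreover have "odd p" if "(p, a, b) \<in> pos_forms K" for p a b
    using pos_forms_odd[OF that] assms by presburger
  ultimately have *: "odd p" "even (a - b)" if "(p, a, b) \<in> pos_forms K" for p a b
    using that by auto
  have "(\<Sum>(p, a, b)\<in>pos_forms K. (of_bool (p > a - b) - of_bool (p > \<bar>a - b\<bar>)) * chi p) = 0"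
  proof (rule sum_pos_forms_sym_0)
    fix p a b assume "(p, a, b) \<in> pos_forms K"
    hence "p \<noteq> a - b" "p \<noteq> b - a" using *[of p a b] by auto
    thus "of_bool (- p > a - b) - of_bool (- p > \<bar>a - b\<bar>) = (of_bool (p > a - b) - of_bool (p > \<bar>a - b\<bar>) :: int)"
      by (auto simp: of_bool_def abs_if)
  qed
  thus ?thesis by (simp add: case_prod_unfold left_diff_distrib sum_subtractf)
qed

section \<open>Evaluation of the signed sum over \<open>4 * z\<^sup>2 + d * e = K\<close>\<close>

definition balanced_forms :: "int \<Rightarrow> (int \<times> int \<times> int) set" where
  "balanced_forms K = {(p, a, b). even (a - b) \<and> p > \<bar>a - b\<bar> \<and> p\<^sup>2 + 4 * a * b = K}"

definition sq4_products :: "int \<Rightarrow> (int \<times> int \<times> int) set" where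
  "sq4_products K = {(z, d, e). d > 0 \<and> e > 0 \<and> 4 * z\<^sup>2 + d * e = K}"

lemma finite_sq4_products: "finite (sq4_products K)"
proof (rule finite_subset)
  show "sq4_products K \<subseteq> {-K..K} \<times> {0..K} \<times> {0..K}"
  proof (rule subsetI, clarsimp simp only: mem_Sigma_iff split_paired_all)
    fix p a b assume "(p, a, b) \<in> sq4_products K"
    hence h: "a > 0" "b > 0" "4 * p\<^sup>2 + (a * b) = K" by (auto simp: sq4_products_def)
    have "a * b > 0" using h by simp
    moreover have "p\<^sup>2 \<ge> 0" by simp
    ultimately have "p\<^sup>2 \<le> K" "a * b \<le> K" using h by linarith+
    thus "p \<in> {-K..K} \<and> a \<in> {0..K} \<and> b \<in> {0..K}"
      using sq_le_imp_mem_interval pos_mult_le_imp h by blast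
  qed
qed auto

lemma balanced_forms_odd: "(p, a, b) \<in> balanced_forms K \<Longrightarrow> odd K \<Longrightarrow> odd p"
  by (auto simp: balanced_forms_def)

text \<open>This is the inverse of \<open>z = (a + b) / 2\<close>, \<open>d = p + b - a\<close>,
  \<open>e = p + a - b\<close>, under which \<open>4 * z\<^sup>2 + d * e\<close> becomes
  \<open>p\<^sup>2 + 4 * a * b\<close>. Positivity of \<open>d\<close> and \<open>e\<close> turns
  into \<open>p > \<bar>a - b\<bar>\<close>, while \<open>a\<close> and \<open>b\<close> may have
  any sign.\<close>

definition products_to_balanced :: "int \<times> int \<times> int \<Rightarrow> int \<times> int \<times> int" where
  "products_to_balanced = (\<lambda>(z, d, e). ((d + e) div 2, z - (d - e) div 4, z + (d - e) div 4))"

definition balanced_to_products :: "int \<times> int \<times> int \<Rightarrow> int \<times> int \<times> int" where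
  "balanced_to_products = (\<lambda>(p, a, b). ((a + b) div 2, p + b - a, p + a - b))"

lemma odd_mult_mod4:
  fixes d e :: int
  assumes "d * e mod 4 = 1"
  shows "(d - e) mod 4 = 0" "odd d" "odd e"
proof -
  have "d mod 4 \<in> {0,1,2,3}" "e mod 4 \<in> {0,1,2,3}" by (simp; presburger)+
  moreover have "d * e mod 4 = ((d mod 4) * (e mod 4)) mod 4" by (simp add: mod_mult_eq)
  ultimately have "(d mod 4 = 1 \<and> e mod 4 = 1) \<or> (d mod 4 = 3 \<and> e mod 4 = 3)"
    using assms by auto
  thus "(d - e) mod 4 = 0" "odd d" "odd e" by presburger+
qed

text \<open>With \<open>d - e = 4 * r\<close> one has \<open>d = p + 2 * r\<close> and
  \<open>a = z - r\<close>. The factor \<open>eps r\<close> that \<open>chi\<close> picks up from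
  \<open>d\<close> to \<open>p\<close> is the one by which \<open>eps z\<close> and
  \<open>eps a\<close> differ.\<close>

lemma products_to_balanced:
  assumes "x \<in> sq4_products K" "K mod 4 = 1"
  shows "products_to_balanced x \<in> balanced_forms K" "balanced_to_products (products_to_balanced x) = x"
    "(case products_to_balanced x of (p, a, b) \<Rightarrow> eps a * chi p) = (case x of (z, d, e) \<Rightarrow> eps z * chi d)"
proof -
  obtain z d e where x: "x = (z, d, e)" and h: "d > 0" "e > 0" "4 * z\<^sup>2 + d * e = K"
    using assms by (auto simp: sq4_products_def)
  have "d * e = K - 4 * z\<^sup>2" using h by simp
  hence "d * e mod 4 = 1" using assms(2) by presburger
  note de = odd_mult_mod4[OF this]
  obtain r where r: "d - e = 4 * r" using de(1) by fastforce
  define p where "p = e + 2 * r"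
  have d: "d = p + 2 * r" and e: "e = p - 2 * r" using r p_def by auto
  have tp: "products_to_balanced x = (p, z - r, z + r)" by (simp add: products_to_balanced_def x d e)
  show "products_to_balanced x \<in> balanced_forms K"
    using h by (auto simp: tp balanced_forms_def d e power2_eq_square algebra_simps)
  show "balanced_to_products (products_to_balanced x) = x" unfolding tp by (simp add: balanced_to_products_def x d e)
  have "odd p" using de d by simp
  thus "(case products_to_balanced x of (p, a, b) \<Rightarrow> eps a * chi p) = (case x of (z, d, e) \<Rightarrow> eps z * chi d)"
    unfolding tp by (simp add: x d chi_add_double eps_diff)
qed

lemma balanced_to_products:
  assumes "x \<in> balanced_forms K"
  shows "balanced_to_products x \<in> sq4_products K" "products_to_balanced (balanced_to_products x) = x"
proof -
  obtain p a b where x: "x = (p, a, b)" and h: "even (a - b)" "p > \<bar>a - b\<bar>" "p\<^sup>2 + 4 * a * b = K"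
    using assms by (auto simp: balanced_forms_def)
  obtain r where r: "b = a + 2 * r" using h(1)
    by (metis add_diff_cancel_left' diff_add_cancel evenE dvd_diff_commute)
  have fp: "balanced_to_products x = (a + r, p + 2 * r, p - 2 * r)" by (simp add: balanced_to_products_def x r)
  show "balanced_to_products x \<in> sq4_products K"
    using h by (auto simp: fp sq4_products_def r power2_eq_square algebra_simps)
  show "products_to_balanced (balanced_to_products x) = x" unfolding fp by (simp add: products_to_balanced_def x r)
qed

lemma sum_sq4_products_eq_sum_balanced_forms:
  assumes "K mod 4 = 1"
  shows "(\<Sum>(z, d, e)\<in>sq4_products K. eps z * chi d) = (\<Sum>(p, a, b)\<in>balanced_forms K. eps a * chi p)"
  by (rule sum.reindex_bij_witness[of _ balanced_to_products products_to_balanced]) (use products_to_balanced[OF _ assms] balanced_to_products in auto)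

lemma finite_balanced_forms: "finite (balanced_forms K)"
proof -
  have "balanced_forms K \<subseteq> products_to_balanced ` sq4_products K" using balanced_to_products by (metis image_eqI subsetI)
  thus ?thesis using finite_sq4_products finite_surj by blast
qed

lemma sum_balanced_forms_pos:
  "(\<Sum>(p, a, b)\<in>balanced_forms K. of_bool (a > 0 \<and> b > 0) * (eps a * chi p)) =
   (\<Sum>(p, a, b)\<in>pos_forms K. of_bool (even (a - b) \<and> p > \<bar>a - b\<bar>) * (eps a * chi p))"
  (is "?L = ?R")
proof -
  have "?L = (\<Sum>(p, a, b)\<in>balanced_forms K \<inter> pos_forms K. eps a * chi p)"
    by (rule sum.mono_neutral_cong_right) (use finite_balanced_forms in \<open>auto simp: balanced_forms_def pos_forms_def\<close>)
  also have "\<dots> = ?R"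
    by (rule sum.mono_neutral_cong_left) (use finite_pos_forms in \<open>auto simp: balanced_forms_def pos_forms_def\<close>)
  finally show ?thesis .
qed

text \<open>
  For \<open>a > 0 > b\<close> the number \<open>h = p - a + b\<close> is positive, and \<open>p\<^sup>2 + 4 a b = (p + 2 b)\<^sup>2 + 4 h (- b)\<close>
  turns an indefinite solution into one with both factors positive.
\<close>

lemma sum_balanced_forms_mixed:
  assumes "odd K"
  shows "(\<Sum>(p, a, b)\<in>balanced_forms K. of_bool (a > 0 \<and> b < 0) * (eps a * chi p)) =
   (\<Sum>(p, a, b)\<in>pos_forms K. of_bool (odd a \<and> p > a - b) * chi p)"
  (is "?L = ?R")
proof -
  have "?L = (\<Sum>(p, a, b)\<in>{(p, a, b)\<in>balanced_forms K. a > 0 \<and> b < 0}. eps a * chi p)"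
    by (rule sum.mono_neutral_cong_right) (auto simp: finite_balanced_forms)
  also have "\<dots> = (\<Sum>(p, a, b)\<in>{(p, a, b)\<in>pos_forms K. odd a \<and> p > a - b}. chi p)"
  proof (rule sum.reindex_bij_witness[of _ "\<lambda>(p, h, c). (p + 2 * c, p + c - h, - c)"
        "\<lambda>(p, a, b). (p + 2 * b, p - a + b, - b)"])
    fix x assume "x \<in> {(p, a, b)\<in>balanced_forms K. a > 0 \<and> b < 0}"
    then obtain p a b where x: "x = (p, a, b)" and h: "(p, a, b) \<in> balanced_forms K" "a > 0" "b < 0" by auto
    have p: "odd p" using balanced_forms_odd h assms by blast
    \<comment> \<open>The bound \<open>p > \<bar>a - b\<bar>\<close> becomes positivity of
      \<open>p - a + b\<close>, and \<open>a > 0\<close> becomes the inequality of the target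
      region. The new middle entry is odd because \<open>p\<close> is odd and \<open>a - b\<close>
      is even.\<close>
    show "(case x of (p, a, b) \<Rightarrow> (p + 2 * b, p - a + b, - b)) \<in> {(p, a, b)\<in>pos_forms K. odd a \<and> p > a - b}"
      using h p by (auto simp: x balanced_forms_def pos_forms_def power2_eq_square algebra_simps)
    have "eps b = eps a" using h by (auto simp: balanced_forms_def eps_def)
    thus "(case case x of (p, a, b) \<Rightarrow> (p + 2 * b, p - a + b, - b) of (p, a, b) \<Rightarrow> chi p) =
        (case x of (p, a, b) \<Rightarrow> eps a * chi p)" using chi_add_double[OF p] by (simp add: x)
  next
    fix x assume "x \<in> {(p, a, b)\<in>pos_forms K. odd a \<and> p > a - b}"
    then obtain p h c where x: "x = (p, h, c)" and h: "(p, h, c) \<in> pos_forms K" "odd h" "p > h - c" by auto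
    have p: "odd p" using pos_forms_odd h assms by blast
    show "(case x of (p, h, c) \<Rightarrow> (p + 2 * c, p + c - h, - c)) \<in> {(p, a, b)\<in>balanced_forms K. a > 0 \<and> b < 0}"
      using h p by (auto simp: x balanced_forms_def pos_forms_def power2_eq_square algebra_simps)
  qed auto
  also have "\<dots> = ?R"
    by (rule sum.mono_neutral_cong_left) (auto simp: finite_pos_forms)
  finally show ?thesis .
qed

text \<open>Negating \<open>a\<close> and \<open>b\<close> together preserves both the set and the
  weight, so opposite sign quadrants contribute equally.\<close>

lemma sum_balanced_forms_split:
  "(\<Sum>(p, a, b)\<in>balanced_forms K. eps a * chi p) =
    (\<Sum>(p, a, b)\<in>balanced_forms K. of_bool (a * b = 0) * (eps a * chi p)) +
    2 * (\<Sum>(p, a, b)\<in>balanced_forms K. of_bool (a > 0 \<and> b > 0) * (eps a * chi p)) +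
    2 * (\<Sum>(p, a, b)\<in>balanced_forms K. of_bool (a > 0 \<and> b < 0) * (eps a * chi p))"
proof -
  define S where "S g = (\<Sum>(p, a, b)\<in>balanced_forms K. g a b * (eps a * chi p))" for g :: "int \<Rightarrow> int \<Rightarrow> int"
  have S_add: "S g + S h = S (\<lambda>a b. g a b + h a b)" for g h
    unfolding S_def by (simp add: sum.distrib[symmetric] case_prod_unfold algebra_simps)
  have S_neg: "S g = S (\<lambda>a b. g (- a) (- b))" for g
    unfolding S_def
    by (rule sum.reindex_bij_witness[of _ "\<lambda>(p, a, b). (p, - a, - b)" "\<lambda>(p, a, b). (p, - a, - b)"])
      (auto simp: balanced_forms_def)
  have "S (\<lambda>a b. 1) = S (\<lambda>a b. of_bool (a * b = 0)) + (S (\<lambda>a b. of_bool (a > 0 \<and> b > 0)) +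
     S (\<lambda>a b. of_bool (a < 0 \<and> b < 0))) + (S (\<lambda>a b. of_bool (a > 0 \<and> b < 0)) + S (\<lambda>a b. of_bool (a < 0 \<and> b > 0)))"
    unfolding S_add by (rule arg_cong[of _ _ S]) (auto simp: fun_eq_iff of_bool_def)
  moreover have "S (\<lambda>a b. of_bool (a < 0 \<and> b < 0)) = S (\<lambda>a b. of_bool (a > 0 \<and> b > 0))"
    "S (\<lambda>a b. of_bool (a < 0 \<and> b > 0)) = S (\<lambda>a b. of_bool (a > 0 \<and> b < 0))"
    by (subst S_neg, simp)+
  ultimately show ?thesis unfolding S_def by simp
qed

text \<open>The axis \<open>a * b = 0\<close> is empty, since it would make \<open>K\<close> an odd
  square. In \<open>pos_forms K\<close> both \<open>a\<close> and \<open>b\<close> are odd, so the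
  part with \<open>a, b > 0\<close> carries the sign -1 and cancels the mixed part.\<close>

lemma sum_sq4_products_mod8_5:
  assumes "K mod 8 = 5"
  shows "(\<Sum>(z, d, e)\<in>sq4_products K. eps z * chi d) = 0"
proof -
  have K: "odd K" "K mod 4 = 1" using assms by presburger+
  have ab: "odd a \<and> odd b" if "(p, a, b) \<in> pos_forms K" for p a b
    using pos_forms_mod8[OF that K(1)] assms by (auto split: if_splits)
  have "(\<Sum>(p, a, b)\<in>balanced_forms K. of_bool (a * b = 0) * (eps a * chi p)) = 0"
  proof (rule sum.neutral, clarify)
    fix p a b assume h: "(p, a, b) \<in> balanced_forms K"
    have "a * b \<noteq> 0"
    proof
      assume "a * b = 0"
      hence "K = p\<^sup>2" using h by (auto simp: balanced_forms_def)
      thus False using odd_sq_mod8[OF balanced_forms_odd[OF h K(1)]] assms by simp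
    qed
    thus "of_bool (a * b = 0) * (eps a * chi p) = 0" by simp
  qed
  moreover have "(\<Sum>(p, a, b)\<in>pos_forms K. of_bool (even (a - b) \<and> p > \<bar>a - b\<bar>) * (eps a * chi p)) =
     - (\<Sum>(p, a, b)\<in>pos_forms K. of_bool (p > \<bar>a - b\<bar>) * chi p)"
    unfolding sum_negf[symmetric] using ab by (intro sum.cong) (auto simp: eps_def)
  moreover have "(\<Sum>(p, a, b)\<in>pos_forms K. of_bool (odd a \<and> p > a - b) * chi p) =
     (\<Sum>(p, a, b)\<in>pos_forms K. of_bool (p > a - b) * chi p)"
    using ab by (intro sum.cong) auto
  ultimately show ?thesis
    using sum_sq4_products_eq_sum_balanced_forms[OF K(2)] sum_balanced_forms_split[of K] sum_balanced_forms_pos[of K] sum_balanced_forms_mixed[OF K(1)]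
      sum_pos_forms_pos_neg_mod8_5[OF assms] by simp
qed

text \<open>Now \<open>a * b\<close> is even in \<open>pos_forms K\<close>. The positive part thus
  has \<open>a\<close> and \<open>b\<close> both even, and the transformed mixed part has
  \<open>a\<close> odd and \<open>b\<close> even. Only boundary terms survive, and these require
  \<open>K = p\<^sup>2\<close> or \<open>K = (a + b)\<^sup>2\<close>.\<close>

lemma sum_sq4_products_mod8_1:
  assumes "K mod 8 = 1"
  shows "(\<Sum>(z, d, e)\<in>sq4_products K. eps z * chi d) =
    (\<Sum>(p, a, b)\<in>balanced_forms K. of_bool (a * b = 0) * (eps a * chi p)) +
    2 * (\<Sum>(p, a, b)\<in>pos_forms K. of_bool (odd a \<and> even b \<and> p = b - a) * chi p)"
proof -
  have K: "odd K" "K mod 4 = 1" using assms by presburger+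
  have ab: "even a \<or> even b" if "(p, a, b) \<in> pos_forms K" for p a b
    using pos_forms_mod8[OF that K(1)] assms by (auto split: if_splits)
  have "(\<Sum>(p, a, b)\<in>pos_forms K. of_bool (even (a - b) \<and> p > \<bar>a - b\<bar>) * (eps a * chi p)) =
     (\<Sum>(p, a, b)\<in>pos_forms K. of_bool (even a \<and> even b \<and> p > \<bar>a - b\<bar>) * chi p)"
    using ab by (intro sum.cong) (fastforce simp: eps_def of_bool_def)+
  moreover have "(\<Sum>(p, a, b)\<in>pos_forms K. of_bool (odd a \<and> p > a - b) * chi p) =
     (\<Sum>(p, a, b)\<in>pos_forms K. of_bool (odd a \<and> even b \<and> p > a - b) * chi p)"
    using ab by (intro sum.cong) (fastforce simp: of_bool_def)+
  ultimately show ?thesis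
    using sum_sq4_products_eq_sum_balanced_forms[OF K(2)] sum_balanced_forms_split[of K] sum_balanced_forms_pos[of K] sum_balanced_forms_mixed[OF K(1)]
      sum_pos_forms_pos_neg_mod8_1[OF K(1)] by simp
qed

lemma sum_sq4_products_nonsquare:
  assumes "K mod 4 = 1" "\<And>M. K \<noteq> M\<^sup>2"
  shows "(\<Sum>(z, d, e)\<in>sq4_products K. eps z * chi d) = 0"
proof (cases "K mod 8 = 5")
  case False
  hence K: "K mod 8 = 1" using assms(1) by presburger
  have "(\<Sum>(p, a, b)\<in>balanced_forms K. of_bool (a * b = 0) * (eps a * chi p)) = 0"
    using assms(2) by (intro sum.neutral) (auto simp: balanced_forms_def)
  moreover have "(p, a, b) \<notin> pos_forms K" if "p = b - a" for p a b
  proof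
    assume "(p, a, b) \<in> pos_forms K"
    hence "K = (b + a)\<^sup>2" by (auto simp: pos_forms_def that power2_eq_square algebra_simps)
    thus False using assms(2) by blast
  qed
  hence "(\<Sum>(p, a, b)\<in>pos_forms K. of_bool (odd a \<and> even b \<and> p = b - a) * chi p) = 0"
    by (intro sum.neutral) (auto simp: of_bool_def)
  ultimately show ?thesis using sum_sq4_products_mod8_1[OF K] by simp
qed (rule sum_sq4_products_mod8_5)

lemma sq_eq_pos:
  fixes x y :: int
  assumes "x\<^sup>2 = y\<^sup>2" "x > 0" "y > 0"
  shows "x = y"
  using assms by (simp add: power2_eq_iff)

text \<open>The axis has \<open>2 * M - 1\<close> points of weight \<open>chi M\<close>; the
  diagonal has \<open>(M - 1) / 2\<close> points of weight \<open>- chi M\<close>, counted twice.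
  The total is \<open>M\<close> times \<open>chi M\<close>.\<close>

lemma sum_sq4_products_square:
  assumes "odd M" "M > 0"
  shows "(\<Sum>(z, d, e)\<in>sq4_products (M\<^sup>2). eps z * chi d) = chi M * M"
proof -
  obtain j where j: "M = 2 * j + 1" using assms by (elim oddE)
  have j0: "j \<ge> 0" using j assms by simp
  \<comment> \<open>The condition \<open>M > \<bar>2 * i\<bar>\<close> is
    \<open>i \<in> {-j..j}\<close>. The second arm omits \<open>i = 0\<close>, so that the origin is
    counted once.\<close>
  define B where "B = (\<lambda>i. (M, 0::int, 2 * i)) ` {-j..j} \<union> (\<lambda>i. (M, 2 * i, 0::int)) ` ({-j..j} - {0})"
  have "card B = card {-j..j} + card ({-j..j} - {0})"
    unfolding B_def by (subst card_Un_disjoint) (auto simp: card_image inj_on_def)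
  also have "int \<dots> = 2 * M - 1" using j j0 by simp
  finally have cB: "int (card B) = 2 * M - 1" .
  have B: "B = {(p, a, b) \<in> balanced_forms (M\<^sup>2). a * b = 0}"
  proof (intro Set.set_eqI iffI)
    fix x assume "x \<in> B"
    thus "x \<in> {(p, a, b) \<in> balanced_forms (M\<^sup>2). a * b = 0}" using j j0 by (auto simp: B_def balanced_forms_def)
  next
    fix x assume "x \<in> {(p, a, b) \<in> balanced_forms (M\<^sup>2). a * b = 0}"
    then obtain p a b where x: "x = (p, a, b)" and ab: "a * b = 0" "even (a - b)" "p > \<bar>a - b\<bar>"
      and "p\<^sup>2 = M\<^sup>2"
      by (auto simp: balanced_forms_def)
    hence p: "p = M" using sq_eq_pos assms by simp
    show "x \<in> B"
    proof (cases "a = 0")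
      case True
      then obtain i where "b = 2 * i" using ab by (auto elim: evenE)
      thus ?thesis unfolding B_def using True ab p j by (intro UnI1 image_eqI[of _ _ i]) (auto simp: x)
    next
      case False
      hence "b = 0" "even a" using ab by simp_all
      then obtain i where "b = 0" "a = 2 * i" by (auto elim: evenE)
      thus ?thesis unfolding B_def using False ab p j by (intro UnI2 image_eqI[of _ _ i]) (auto simp: x)
    qed
  qed
  have "(\<Sum>(p, a, b)\<in>balanced_forms (M\<^sup>2). of_bool (a * b = 0) * (eps a * chi p)) = (\<Sum>(p, a, b)\<in>B. eps a * chi p)"
    by (rule sum.mono_neutral_cong_right) (use finite_balanced_forms in \<open>auto simp: B\<close>)
  also have "\<dots> = (\<Sum>x\<in>B. chi M)"
    by (rule sum.cong) (auto simp: B_def eps_def)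
  also have "\<dots> = (2 * M - 1) * chi M" using cB by simp
  finally have 1: "(\<Sum>(p, a, b)\<in>balanced_forms (M\<^sup>2). of_bool (a * b = 0) * (eps a * chi p)) = (2 * M - 1) * chi M" .
  \<comment> \<open>On the diagonal \<open>a + b = M\<close>. Putting \<open>a = 2 * i + 1\<close>
    gives \<open>b = 2 * j - 2 * i\<close>, which is positive exactly for \<open>i < j\<close>, and
    \<open>p = M - 2 * a\<close>.\<close>
  define C where "C = (\<lambda>i. (M - 4 * i - 2, 2 * i + 1, 2 * j - 2 * i)) ` {0..<j}"
  have cC: "card C = card {0..<j}" unfolding C_def by (intro card_image) (auto simp: inj_on_def)
  have C: "C = {(p, a, b) \<in> pos_forms (M\<^sup>2). odd a \<and> even b \<and> p = b - a}"
  proof (intro Set.set_eqI iffI)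
    fix x assume "x \<in> C"
    thus "x \<in> {(p, a, b) \<in> pos_forms (M\<^sup>2). odd a \<and> even b \<and> p = b - a}"
      by (auto simp: j C_def pos_forms_def power2_eq_square algebra_simps)
  next
    fix x assume "x \<in> {(p, a, b) \<in> pos_forms (M\<^sup>2). odd a \<and> even b \<and> p = b - a}"
    then obtain a b where x: "x = (b - a, a, b)" and ab: "odd a" "a > 0" "b > 0"
      and "(b - a)\<^sup>2 + 4 * a * b = M\<^sup>2"
      by (auto simp: pos_forms_def)
    hence "(a + b)\<^sup>2 = M\<^sup>2" by (simp add: power2_eq_square algebra_simps)
    hence p: "a + b = M" using sq_eq_pos assms ab by simp
    obtain i where i: "a = 2 * i + 1" using ab by (elim oddE)
    have "x = (M - 4 * i - 2, 2 * i + 1, 2 * j - 2 * i)" using p i j by (auto simp: x)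
    moreover have "i \<in> {0..<j}" using p i j ab by auto
    ultimately show "x \<in> C" by (auto simp: C_def)
  qed
  have "(\<Sum>(p, a, b)\<in>pos_forms (M\<^sup>2). of_bool (odd a \<and> even b \<and> p = b - a) * chi p) = (\<Sum>(p, a, b)\<in>C. chi p)"
    by (rule sum.mono_neutral_cong_right) (use finite_pos_forms in \<open>auto simp: C\<close>)
  also have "\<dots> = (\<Sum>x\<in>C. - chi M)"
  proof (rule sum.cong[OF refl])
    fix x assume "x \<in> C"
    then obtain i b where "x = (M - 2 * (2 * i + 1), 2 * i + 1, b)" by (auto simp: C_def)
    thus "(case x of (p, a, b) \<Rightarrow> chi p) = - chi M"
      using chi_diff_double[OF assms(1), of "2 * i + 1"] by (simp add: eps_def)
  qed
  also have "\<dots> = - j * chi M" using cC j0 by simp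
  finally have 2: "(\<Sum>(p, a, b)\<in>pos_forms (M\<^sup>2). of_bool (odd a \<and> even b \<and> p = b - a) * chi p) = - j * chi M" .
  show ?thesis
    unfolding sum_sq4_products_mod8_1[OF odd_sq_mod8[OF assms(1)]] 1 2 by (simp add: j algebra_simps)
qed

subsection \<open>Solutions of $u^2 + 8de = K$\<close>

definition sq8_products :: "int \<Rightarrow> (int \<times> int \<times> int) set" where
  "sq8_products K = {(u, d, e). d > 0 \<and> e > 0 \<and> odd d \<and> u\<^sup>2 + 8 * d * e = K}"

lemma finite_sq8_products: "finite (sq8_products K)"
proof (rule finite_subset)
  show "sq8_products K \<subseteq> (\<lambda>(p, a, b). (p, a, b div 2)) ` pos_forms K"
  proof
    fix x assume "x \<in> sq8_products K"
    then obtain u d e where "x = (u, d, e)" "(u, d, 2 * e) \<in> pos_forms K"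
      by (auto simp: sq8_products_def pos_forms_def)
    thus "x \<in> (\<lambda>(p, a, b). (p, a, b div 2)) ` pos_forms K" by force
  qed
qed (simp add: finite_pos_forms)

text \<open>The target for the part of \<open>sq8_products\<close> with
  \<open>2 * e < u + d\<close>: there \<open>f = (u + d) / 2 - e\<close>, and the parity condition
  records that \<open>(u + d) / 2\<close> is odd.\<close>

definition sq16_products :: "int \<Rightarrow> (int \<times> int \<times> int) set" where
  "sq16_products K = {(v, e, f). e > 0 \<and> f > 0 \<and> odd (e + f) \<and> v\<^sup>2 + 16 * e * f = K}"

lemma finite_sq16_products: "finite (sq16_products K)"
proof (rule finite_subset)
  show "sq16_products K \<subseteq> (\<lambda>(p, a, b). (p, a, b div 4)) ` pos_forms K"
  proof
    fix x assume "x \<in> sq16_products K"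
    then obtain u d e where "x = (u, d, e)" "(u, d, 4 * e) \<in> pos_forms K"
      by (auto simp: sq16_products_def pos_forms_def)
    thus "x \<in> (\<lambda>(p, a, b). (p, a, b div 4)) ` pos_forms K" by force
  qed
qed (simp add: finite_pos_forms)

text \<open>
  The involution \<open>(v, e, f) \<mapsto> (- v, f, e)\<close> preserves the weight and exchanges the region with its
  complement, so the sum is half of the unrestricted one, which \<open>v \<mapsto> - v\<close> kills.
\<close>

lemma sum_sq16_products_half:
  assumes "odd K"
  shows "(\<Sum>(v, e, f)\<in>{(v, e, f)\<in>sq16_products K. v > 2 * (e - f)}. eps e * chi v) = 0"
proof -
  let ?w = "\<lambda>(v, e, f). eps e * chi v"
  define A where "A = {(v, e, f)\<in>sq16_products K. v > 2 * (e - f)}"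
  define B where "B = {(v, e, f)\<in>sq16_products K. v < 2 * (e - f)}"
  have "odd v" if "(v, e, f) \<in> sq16_products K" for v e f using that assms by (auto simp: sq16_products_def)
  hence "v \<noteq> 2 * (e - f)" if "(v, e, f) \<in> sq16_products K" for v e f using that by fastforce
  hence AB: "sq16_products K = A \<union> B" by (force simp: A_def B_def)
  have fin: "finite A" "finite B" using finite_sq16_products[of K] AB by auto
  have "A \<inter> B = {}" by (auto simp: A_def B_def)
  note union = sum.union_disjoint[OF fin this]
  have "sum ?w (sq16_products K) = 0"
    by (rule sum_involution_0[where g = "\<lambda>(v, e, f). (- v, e, f)"]) (auto simp: sq16_products_def)
  also have "sum ?w (sq16_products K) = sum ?w A + sum ?w B"
    unfolding AB by (rule union)
  \<comment> \<open>As \<open>e + f\<close> is odd, \<open>eps f = - eps e\<close>, which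
    compensates the sign from \<open>chi (- v) = - chi v\<close>.\<close>
  also have "sum ?w B = sum ?w A"
    by (rule sum.reindex_bij_witness[of _ "\<lambda>(v, e, f). (- v, f, e)" "\<lambda>(v, e, f). (- v, f, e)"])
      (auto simp: A_def B_def sq16_products_def eps_def algebra_simps)
  finally show ?thesis by (simp add: A_def)
qed

text \<open>
  By \<open>u \<mapsto> - u\<close> it suffices to treat \<open>u \<equiv> d (mod 4)\<close>. There
  \<open>(u, d, e) \<mapsto> (- u - 2 d, d, e - (u + d) / 2)\<close> changes the sign of the weight wherever it keeps the last
  entry positive; the part with \<open>2 e < u + d\<close> becomes a sum over \<open>v\<^sup>2 + 16 e f = K\<close>.
\<close>

lemma sum_sq8_products:
  assumes "K mod 8 = 1"
  shows "(\<Sum>(u, d, e)\<in>sq8_products K. eps e * chi d) =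
    2 * (\<Sum>(u, d, e)\<in>{(u, d, e)\<in>sq8_products K. 4 dvd u - d \<and> 2 * e = u + d}. - chi d)"
proof -
  let ?w = "\<lambda>(u, d, e). eps e * chi d"
  have K: "odd K" using assms by presburger
  have u: "odd u" if "(u, d, e) \<in> sq8_products K" for u d e using that K by (auto simp: sq8_products_def)
  define A where "A = {(u, d, e)\<in>sq8_products K. 4 dvd u - d}"
  define B where "B = {(u, d, e)\<in>sq8_products K. 4 dvd u + d}"
  have d: "odd d" if "(u, d, e) \<in> sq8_products K" for u d e using that by (auto simp: sq8_products_def)
  have "4 dvd u - d \<or> 4 dvd u + d" if "odd u" "odd d" for u d :: int using that by presburger
  hence AB: "sq8_products K = A \<union> B" unfolding A_def B_def using u d by blast
  have "\<not> (4 dvd u - d \<and> 4 dvd u + d)" if "odd u" "odd d" for u d :: int using that by presburger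
  hence AB0: "A \<inter> B = {}" unfolding A_def B_def using u d by blast
  have fin: "finite A" "finite B" using finite_sq8_products[of K] AB by auto
  have "sum ?w (sq8_products K) = sum ?w A + sum ?w B"
    unfolding AB using fin AB0 by (rule sum.union_disjoint)
  also have "sum ?w B = sum ?w A"
    by (rule sum.reindex_bij_witness[of _ "\<lambda>(u, d, e). (- u, d, e)" "\<lambda>(u, d, e). (- u, d, e)"])
      (auto simp: A_def B_def sq8_products_def; presburger)+
  finally have 1: "sum ?w (sq8_products K) = 2 * sum ?w A" by simp
  \<comment> \<open>For odd \<open>u\<close> and \<open>d\<close> that agree mod 4 the half-sum is
    odd. Subtracting it from \<open>e\<close> therefore flips \<open>eps e\<close>.\<close>
  have half: "odd ((u + d) div 2)" "u + d = 2 * ((u + d) div 2)" if "(u, d, e) \<in> A" for u d e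
  proof -
    have "odd u" "odd d" "4 dvd u - d" using that u d by (auto simp: A_def)
    thus "odd ((u + d) div 2)" "u + d = 2 * ((u + d) div 2)" by presburger+
  qed
  define A1 where "A1 = {(u, d, e)\<in>A. 2 * e > u + d}"
  define A2 where "A2 = {(u, d, e)\<in>A. 2 * e < u + d}"
  define A3 where "A3 = {(u, d, e)\<in>A. 2 * e = u + d}"
  have A: "A = (A1 \<union> A2) \<union> A3" by (auto simp: A1_def A2_def A3_def)
  have fin': "finite A1" "finite A2" "finite A3" using fin(1) unfolding A by auto
  have disj: "(A1 \<union> A2) \<inter> A3 = {}" "A1 \<inter> A2 = {}" by (auto simp: A1_def A2_def A3_def)
  have "sum ?w A = sum ?w (A1 \<union> A2) + sum ?w A3"
    unfolding A using fin' disj by (intro sum.union_disjoint) auto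
  also have "sum ?w (A1 \<union> A2) = sum ?w A1 + sum ?w A2"
    using fin' disj by (intro sum.union_disjoint) auto
  also have "sum ?w A1 = 0"
  proof (rule sum_involution_0[where g = "\<lambda>(u, d, e). (- u - 2 * d, d, e - (u + d) div 2)"])
    fix x assume "x \<in> A1"
    then obtain u d e where x: "x = (u, d, e)" and h: "(u, d, e) \<in> A" "2 * e > u + d"
      by (auto simp: A1_def)
    define s where "s = (u + d) div 2"
    have s: "odd s" "u = 2 * s - d" using half[OF h(1)] by (auto simp: s_def)
    have B: "d > 0" "e > 0" "odd d" "u\<^sup>2 + 8 * d * e = K" "4 dvd u - d" using h by (auto simp: A_def sq8_products_def)
    have "(- u - 2 * d, d, e - s) \<in> A1"
      using B h(2) by (auto simp: A1_def A_def sq8_products_def s(2) power2_eq_square algebra_simps)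
    thus "(case x of (u, d, e) \<Rightarrow> (- u - 2 * d, d, e - (u + d) div 2)) \<in> A1" by (simp add: x s_def)
    show "(case case x of (u, d, e) \<Rightarrow> (- u - 2 * d, d, e - (u + d) div 2) of
        (u, d, e) \<Rightarrow> (- u - 2 * d, d, e - (u + d) div 2)) = x"
      by (simp add: x s(2))
    show "?w (case x of (u, d, e) \<Rightarrow> (- u - 2 * d, d, e - (u + d) div 2)) = - ?w x"
      using s(1) by (simp add: x s_def[symmetric] eps_diff) (simp add: eps_def)
  qed
  \<comment> \<open>With \<open>v = 4 * e - u\<close> and \<open>f = (u + d) / 2 - e\<close>,
    positivity of \<open>f\<close> is the condition of \<open>A2\<close>, and \<open>d > 0\<close>
    becomes \<open>v > 2 * (e - f)\<close>. The sign arises from \<open>v \<equiv> - d\<close> mod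
    4.\<close>
  also have "sum ?w A2 = (\<Sum>(v, e, f)\<in>{(v, e, f)\<in>sq16_products K. v > 2 * (e - f)}. - (eps e * chi v))"
  proof (rule sum.reindex_bij_witness[of _ "\<lambda>(v, e, f). (4 * e - v, v - 2 * (e - f), e)"
      "\<lambda>(u, d, e). (4 * e - u, e, (u + d) div 2 - e)"])
    fix x assume "x \<in> A2"
    then obtain u d e where x: "x = (u, d, e)" and h: "(u, d, e) \<in> A" "2 * e < u + d"
      by (auto simp: A2_def)
    define s where "s = (u + d) div 2"
    have s: "odd s" "u = 2 * s - d" using half[OF h(1)] by (auto simp: s_def)
    have B: "d > 0" "e > 0" "odd d" "u\<^sup>2 + 8 * d * e = K" "4 dvd u - d" using h by (auto simp: A_def sq8_products_def)
    show "(case x of (u, d, e) \<Rightarrow> (4 * e - u, e, (u + d) div 2 - e)) \<in> {(v, e, f)\<in>sq16_products K. v > 2 * (e - f)}"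
      using B h(2) s(1) by (auto simp: x sq16_products_def s(2) power2_eq_square algebra_simps)
    show "(case case x of (u, d, e) \<Rightarrow> (4 * e - u, e, (u + d) div 2 - e) of
        (v, e, f) \<Rightarrow> (4 * e - v, v - 2 * (e - f), e)) = x"
      by (simp add: x s(2))
    have "chi (4 * e - u) = - chi (u - 4 * e)" using chi_minus[of "u - 4 * e"] by simp
    also have "(u - 4 * e) mod 4 = d mod 4" using B(5) by presburger
    hence "chi (u - 4 * e) = chi d" by (rule chi_cong)
    finally show "(case case x of (u, d, e) \<Rightarrow> (4 * e - u, e, (u + d) div 2 - e) of
        (v, e, f) \<Rightarrow> - (eps e * chi v)) = ?w x"
      by (simp add: x)
  next
    fix x assume "x \<in> {(v, e, f)\<in>sq16_products K. v > 2 * (e - f)}"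
    then obtain v e f where x: "x = (v, e, f)" and h: "(v, e, f) \<in> sq16_products K" "v > 2 * (e - f)" by auto
    have h': "e > 0" "f > 0" "odd (e + f)" "v\<^sup>2 + 16 * e * f = K" using h by (auto simp: sq16_products_def)
    have v: "odd v" using h' K by auto
    show "(case case x of (v, e, f) \<Rightarrow> (4 * e - v, v - 2 * (e - f), e) of
        (u, d, e) \<Rightarrow> (4 * e - u, e, (u + d) div 2 - e)) = x"
      by (simp add: x)
    have "4 dvd 4 * e - v - (v - 2 * (e - f))" using v h'(3) by presburger
    thus "(case x of (v, e, f) \<Rightarrow> (4 * e - v, v - 2 * (e - f), e)) \<in> A2"
      using h h' v by (simp add: x A2_def A_def sq8_products_def) (simp add: power2_eq_square algebra_simps)
  qed
  also have "\<dots> = 0" using sum_sq16_products_half[OF K] by (simp add: sum_negf case_prod_unfold)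
  \<comment> \<open>On this boundary \<open>e = (u + d) / 2\<close> is odd, so
    \<open>eps e = -1\<close>.\<close>
  also have "sum ?w A3 = (\<Sum>(u, d, e)\<in>{(u, d, e)\<in>sq8_products K. 4 dvd u - d \<and> 2 * e = u + d}. - chi d)"
  proof (rule sum.cong)
    fix x assume "x \<in> {(u, d, e) \<in> sq8_products K. 4 dvd u - d \<and> 2 * e = u + d}"
    then obtain u d e where x: "x = (u, d, e)" "(u, d, e) \<in> A" "2 * e = u + d" by (auto simp: A_def)
    thus "?w x = (case x of (u, d, e) \<Rightarrow> - chi d)"
      using half(1)[of u d e] by (simp add: eps_def flip: x(3))
  qed (auto simp: A3_def A_def)
  finally show ?thesis using 1 by simp
qed

text \<open>A boundary term with \<open>2 * e = u + d\<close> would give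
  \<open>K = (u + 2 * d)\<^sup>2\<close>.\<close>

lemma sum_sq8_products_nonsquare:
  assumes "K mod 8 = 1" "\<And>M. K \<noteq> M\<^sup>2"
  shows "(\<Sum>(u, d, e)\<in>sq8_products K. eps e * chi d) = 0"
proof -
  have False if "(u, d, e) \<in> sq8_products K" "2 * e = u + d" for u d e
  proof -
    have "K = u\<^sup>2 + 8 * d * e" using that(1) by (simp add: sq8_products_def)
    also have "\<dots> = u\<^sup>2 + 4 * d * (2 * e)" by simp
    also have "\<dots> = (u + 2 * d)\<^sup>2" unfolding that(2) by (simp add: power2_eq_square algebra_simps)
    finally show False using assms(2) by blast
  qed
  hence "{(u, d, e)\<in>sq8_products K. 4 dvd u - d \<and> 2 * e = u + d} = {}" by auto
  thus ?thesis using sum_sq8_products[OF assms(1)] by (simp only: sum.empty)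
qed

text \<open>This counts the boundary terms for \<open>K = M\<^sup>2\<close>: there
  \<open>u = M - 2 * d\<close>, so \<open>4 dvd u - d\<close> amounts to
  \<open>4 dvd M + d\<close>.\<close>

lemma card_odd_residue_class_below:
  assumes "odd M" "M > 0"
  shows "4 * int (card {d. 0 < d \<and> d < M \<and> 4 dvd M + d}) = M - chi M"
proof -
  have "M mod 4 = 1 \<or> M mod 4 = 3" using assms by presburger
  thus ?thesis
  proof
    assume M: "M mod 4 = 1"
    define j where "j = M div 4"
    have j: "M = 4 * j + 1" "j \<ge> 0" unfolding j_def using M assms(2) by presburger+
    have "{d. 0 < d \<and> d < M \<and> 4 dvd M + d} = (\<lambda>i. 4 * i + 3) ` {0..<j}"
    proof (intro Set.set_eqI iffI)
      fix d assume d: "d \<in> {d. 0 < d \<and> d < M \<and> 4 dvd M + d}"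
      hence "d = 4 * (d div 4) + 3" "d div 4 \<in> {0..<j}" using j by (auto; presburger)+
      thus "d \<in> (\<lambda>i. 4 * i + 3) ` {0..<j}" by blast
    qed (use j in auto)
    also have "card \<dots> = nat j" by (subst card_image) (auto simp: inj_on_def)
    finally show ?thesis using j M by (simp add: chi_def)
  next
    assume M: "M mod 4 = 3"
    define j where "j = M div 4"
    have j: "M = 4 * j + 3" "j \<ge> 0" unfolding j_def using M assms(2) by presburger+
    have "{d. 0 < d \<and> d < M \<and> 4 dvd M + d} = (\<lambda>i. 4 * i + 1) ` {0..j}"
    proof (intro Set.set_eqI iffI)
      fix d assume d: "d \<in> {d. 0 < d \<and> d < M \<and> 4 dvd M + d}"
      hence "d = 4 * (d div 4) + 1" "d div 4 \<in> {0..j}" using j by (auto; presburger)+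
      thus "d \<in> (\<lambda>i. 4 * i + 1) ` {0..j}" by blast
    qed (use j in auto)
    also have "card \<dots> = nat (j + 1)" by (subst card_image) (auto simp: inj_on_def)
    finally show ?thesis using j M by (simp add: chi_def)
  qed
qed

lemma chi_sq: "odd x \<Longrightarrow> chi x * chi x = 1"
proof -
  assume "odd x"
  hence "x mod 4 = 1 \<or> x mod 4 = 3" by presburger
  thus ?thesis by (auto simp: chi_def)
qed

text \<open>A boundary term is determined by \<open>d\<close>, since \<open>u + 2 * d = M\<close>.
  It contributes \<open>- chi d = chi M\<close> because \<open>d \<equiv> - M\<close> mod 4, and the
  number of admissible \<open>d\<close> is \<open>(M - chi M) / 4\<close>.\<close>

lemma sum_sq8_products_square:
  assumes "odd M" "M > 0"
  shows "2 * (\<Sum>(u, d, e)\<in>sq8_products (M\<^sup>2). eps e * chi d) = chi M * M - 1"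
proof -
  define C where "C = {d. 0 < d \<and> d < M \<and> 4 dvd M + d}"
  have C2: "odd d" "chi d = - chi M" "2 * ((M - d) div 2) = M - d" if "d \<in> C" for d
  proof -
    have d: "4 dvd M + d" using that by (simp add: C_def)
    thus "odd d" "2 * ((M - d) div 2) = M - d" using assms(1) by presburger+
    have "d mod 4 = (- M) mod 4" using d by presburger
    hence "chi d = chi (- M)" by (rule chi_cong)
    thus "chi d = - chi M" by simp
  qed
  have "(\<Sum>(u, d, e)\<in>{(u, d, e)\<in>sq8_products (M\<^sup>2). 4 dvd u - d \<and> 2 * e = u + d}. - chi d) = (\<Sum>d\<in>C. chi M)"
  proof (rule sum.reindex_bij_witness[of _ "\<lambda>d. (M - 2 * d, d, (M - d) div 2)" "\<lambda>(u, d, e). d"])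
    fix x assume "x \<in> {(u, d, e)\<in>sq8_products (M\<^sup>2). 4 dvd u - d \<and> 2 * e = u + d}"
    then obtain u d e where x: "x = (u, d, e)" and h: "d > 0" "e > 0" "odd d" "u\<^sup>2 + 8 * d * e = M\<^sup>2"
      "4 dvd u - d" "2 * e = u + d" by (auto simp: sq8_products_def)
    have "M\<^sup>2 = u\<^sup>2 + 8 * d * e" using h(4) by simp
    also have "\<dots> = u\<^sup>2 + 4 * d * (2 * e)" by simp
    also have "\<dots> = (u + 2 * d)\<^sup>2" unfolding h(6) by (simp add: power2_eq_square algebra_simps)
    finally have "u + 2 * d = M" using sq_eq_pos[of "u + 2 * d" M] assms h by simp
    hence u: "u = M - 2 * d" by simp
    show "(M - 2 * (case x of (u, d, e) \<Rightarrow> d), case x of (u, d, e) \<Rightarrow> d, (M - (case x of (u, d, e) \<Rightarrow> d)) div 2) = x"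
      using h(6) by (simp add: x u)
    have "d \<in> C" using h by (auto simp: C_def u) presburger
    thus "(case x of (u, d, e) \<Rightarrow> d) \<in> C" "chi M = (case x of (u, d, e) \<Rightarrow> - chi d)"
      using C2(2)[of d] by (auto simp: x)
  next
    fix d assume d: "d \<in> C"
    define e where "e = (M - d) div 2"
    have M: "M = d + 2 * e" using C2(3)[OF d] by (simp add: e_def)
    have "(M - 2 * d, d, e) \<in> sq8_products (M\<^sup>2)"
      using C2(1)[OF d] d by (auto simp: sq8_products_def C_def M power2_eq_square algebra_simps)
    moreover have "4 dvd M - 2 * d - d" using d by (auto simp: C_def) presburger
    ultimately show "(M - 2 * d, d, (M - d) div 2) \<in> {(u, d, e)\<in>sq8_products (M\<^sup>2). 4 dvd u - d \<and> 2 * e = u + d}"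
      using M by (auto simp flip: e_def)
  qed auto
  also have "\<dots> = int (card C) * chi M" by simp
  finally have "2 * (\<Sum>(u, d, e)\<in>sq8_products (M\<^sup>2). eps e * chi d) = (4 * int (card C)) * chi M"
    using sum_sq8_products[OF odd_sq_mod8[OF assms(1)]] by simp
  also have "\<dots> = (M - chi M) * chi M" using card_odd_residue_class_below[OF assms] by (simp add: C_def)
  also have "\<dots> = chi M * M - 1" using chi_sq[OF assms(1)] by (simp add: algebra_simps)
  finally show ?thesis .
qed

subsection \<open>Sums of two squares\<close>

definition two_squares :: "int \<Rightarrow> (int \<times> int) set" where
  "two_squares n = {(x, y). x\<^sup>2 + y\<^sup>2 = n}"

text \<open>Factor pairs, rather than divisors, match the fibres of \<open>sq4_products\<close> and
  \<open>sq8_products\<close> and make the exchange of the two factors a plain swap.\<close>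

definition chi_sum :: "int \<Rightarrow> int" where
  "chi_sum n = (\<Sum>(d, e)\<in>{(d, e). d > 0 \<and> e > 0 \<and> d * e = n}. chi d)"

lemma finite_divisor_pairs: "finite {(d, e). d > 0 \<and> e > 0 \<and> d * e = (n::int)}"
proof (rule finite_subset)
  show "{(d, e). d > 0 \<and> e > 0 \<and> d * e = n} \<subseteq> {0..n} \<times> {0..n}"
    using pos_mult_le_imp[of _ _ n] by blast
qed auto

lemma finite_two_squares: "finite (two_squares n)"
proof (rule finite_subset)
  show "two_squares n \<subseteq> {-n..n} \<times> {-n..n}"
  proof
    fix x assume "x \<in> two_squares n"
    then obtain a b where x: "x = (a, b)" "a\<^sup>2 + b\<^sup>2 = n" by (auto simp: two_squares_def)
    moreover have "a\<^sup>2 \<ge> 0" "b\<^sup>2 \<ge> 0" by simp_all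
    ultimately have "a\<^sup>2 \<le> n" "b\<^sup>2 \<le> n" by linarith+
    thus "x \<in> {-n..n} \<times> {-n..n}" using sq_le_imp_mem_interval x by blast
  qed
qed auto

lemma chi_sum_nonpos: "n \<le> 0 \<Longrightarrow> chi_sum n = 0"
proof -
  assume "n \<le> 0"
  hence "{(d, e). d > 0 \<and> e > 0 \<and> d * e = n} = {}" using mult_pos_pos by fastforce
  thus ?thesis by (simp only: chi_sum_def sum.empty)
qed

lemma two_squares_neg: "n < 0 \<Longrightarrow> two_squares n = {}"
  by (auto simp: two_squares_def not_sum_power2_lt_zero)

lemma two_squares_0: "two_squares 0 = {(0, 0)}"
  by (auto simp: two_squares_def sum_power2_eq_zero_iff)

text \<open>Up to the order of the coordinates, the bijection is multiplication by 1 + i on Gaussian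
  integers. It is onto because \<open>x\<close> and \<open>y\<close> have equal parity when
  \<open>x\<^sup>2 + y\<^sup>2\<close> is even.\<close>

lemma card_two_squares_double: "card (two_squares (2 * n)) = card (two_squares n)"
proof (rule bij_betw_same_card[symmetric])
  show "bij_betw (\<lambda>(x, y). (x + y, x - y)) (two_squares n) (two_squares (2 * n))"
  proof (rule bij_betw_byWitness[where f' = "\<lambda>(x, y). ((x + y) div 2, (x - y) div 2)"])
    show "\<forall>a\<in>two_squares (2 * n). (case case a of (x, y) \<Rightarrow> ((x + y) div 2, (x - y) div 2) of (x, y) \<Rightarrow> (x + y, x - y)) = a"
      and "(\<lambda>(x, y). ((x + y) div 2, (x - y) div 2)) ` two_squares (2 * n) \<subseteq> two_squares n"
    proof -
      have *: "\<exists>a b. x = a + b \<and> y = a - b \<and> (a, b) \<in> two_squares n" if "(x, y) \<in> two_squares (2 * n)" for x y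
      proof -
        have xy: "x\<^sup>2 + y\<^sup>2 = 2 * n" using that by (simp add: two_squares_def)
        hence "even (x\<^sup>2 + y\<^sup>2)" by simp
        hence "even (x - y)" by simp
        then obtain b where b: "x = y + 2 * b" by (metis evenE diff_add_cancel add.commute)
        have "(y + b, b) \<in> two_squares n" using xy by (simp add: two_squares_def b power2_eq_square algebra_simps)
        thus ?thesis using b by (intro exI[of _ "y + b"] exI[of _ b]) auto
      qed
      show "\<forall>a\<in>two_squares (2 * n). (case case a of (x, y) \<Rightarrow> ((x + y) div 2, (x - y) div 2) of (x, y) \<Rightarrow> (x + y, x - y)) = a"
        by (clarify, drule *) auto
      show "(\<lambda>(x, y). ((x + y) div 2, (x - y) div 2)) ` two_squares (2 * n) \<subseteq> two_squares n"
        by (clarify, drule *) auto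
    qed
  qed (auto simp: two_squares_def power2_eq_square algebra_simps)
qed

text \<open>Only odd \<open>d\<close> carry weight, so the factor 2 always belongs to the cofactor
  \<open>e\<close>.\<close>

lemma chi_sum_double: "chi_sum (2 * n) = chi_sum n"
proof -
  have *: "chi_sum n = (\<Sum>(d, e)\<in>{(d, e). d > 0 \<and> e > 0 \<and> d * e = n \<and> odd d}. chi d)" for n
    unfolding chi_sum_def
    by (rule sum.mono_neutral_right) (use finite_divisor_pairs[of n] in \<open>auto simp: chi_even\<close>)
  have "\<exists>f. e = 2 * f \<and> d * f = n" if "d * e = 2 * n" "odd d" for d e :: int
  proof -
    have "even (d * e)" using that(1) by simp
    hence "even e" using that(2) by simp
    then obtain f where "e = 2 * f" by (elim evenE)
    thus ?thesis using that(1) by auto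
  qed
  note e = this
  show ?thesis
    unfolding *[of n] *[of "2 * n"]
    by (rule sum.reindex_bij_witness[of _ "\<lambda>(d, e). (d, 2 * e)" "\<lambda>(d, e). (d, e div 2)"])
      (auto dest!: e)
qed

lemma two_squares_mod4_3: "n mod 4 = 3 \<Longrightarrow> two_squares n = {}"
proof (rule ccontr)
  assume n: "n mod 4 = 3" and "two_squares n \<noteq> {}"
  then obtain x y where xy: "n = x\<^sup>2 + y\<^sup>2" by (auto simp: two_squares_def)
  have "x\<^sup>2 mod 4 = 0 \<or> x\<^sup>2 mod 4 = 1" for x :: int
  proof (cases "even x")
    case True
    then obtain k where "x = 2 * k" by (elim evenE)
    hence "x\<^sup>2 = 4 * k\<^sup>2" by (simp add: power2_eq_square)
    thus ?thesis by simp
  next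
    case False
    thus ?thesis using odd_sq_mod8[of x] by presburger
  qed
  from this[of x] this[of y] show False using n xy by presburger
qed

text \<open>If \<open>d * e \<equiv> 3\<close> mod 4 then \<open>d \<equiv> - e\<close> mod 4, so
  swapping the factors negates the weight.\<close>

lemma chi_sum_mod4_3: assumes "n mod 4 = 3" shows "chi_sum n = 0"
  unfolding chi_sum_def
proof (rule sum_involution_0[where g = "\<lambda>(d, e). (e, d)"])
  fix x assume "x \<in> {(d, e). d > 0 \<and> e > 0 \<and> d * e = n}"
  then obtain d e where x: "x = (d, e)" "d * e = n" by auto
  have "d * (- e) = - n" using x(2) by simp
  hence "d * (- e) mod 4 = 1" using assms by presburger
  from odd_mult_mod4(1)[OF this] have "d mod 4 = (- e) mod 4" by presburger
  hence "chi d = - chi e" using chi_cong[of d "- e"] by simp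
  thus "(case case x of (d, e) \<Rightarrow> (e, d) of (d, e) \<Rightarrow> chi d) = - (case x of (d, e) \<Rightarrow> chi d)"
    by (simp add: x)
qed (auto simp: mult.commute)

section \<open>Fibring the divisor sums over the squared variable\<close>

lemma sum_sq4_products_fibres: "(\<Sum>(z, d, e)\<in>sq4_products K. eps z * chi d) = (\<Sum>z\<in>{-K..K}. eps z * chi_sum (K - 4 * z\<^sup>2))"
proof -
  have "(\<Sum>z\<in>{-K..K}. eps z * chi_sum (K - 4 * z\<^sup>2)) =
    (\<Sum>(z, y)\<in>Sigma {-K..K} (\<lambda>z. {(d, e). d > 0 \<and> e > 0 \<and> d * e = K - 4 * z\<^sup>2}). case y of (d, e) \<Rightarrow> eps z * chi d)"
    unfolding chi_sum_def by (subst sum.Sigma[symmetric])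
      (use finite_divisor_pairs in \<open>auto simp: sum_distrib_left case_prod_unfold\<close>)
  also have "Sigma {-K..K} (\<lambda>z. {(d, e). d > 0 \<and> e > 0 \<and> d * e = K - 4 * z\<^sup>2}) = sq4_products K" (is "?A = ?B")
  proof
    show "?B \<subseteq> ?A"
    proof
      fix x assume "x \<in> ?B"
      then obtain z d e where x: "x = (z, d, e)" "d > 0" "e > 0" "4 * z\<^sup>2 + d * e = K" by (auto simp: sq4_products_def)
      have "d * e > 0" using x by simp
      moreover have "z\<^sup>2 \<ge> 0" by simp
      ultimately have "z\<^sup>2 \<le> K" using x(4) by linarith
      thus "x \<in> ?A" using x sq_le_imp_mem_interval[of z K] by auto
    qed
  qed (auto simp: sq4_products_def)
  finally show ?thesis by (simp add: case_prod_unfold)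
qed

text \<open>For \<open>K \<equiv> 1\<close> mod 8 the quotient \<open>(K - u\<^sup>2) div 8\<close>
  is exact on this range. It is negative when \<open>u\<^sup>2 > K\<close>, and then both
  \<open>chi_sum\<close> and the number of representations vanish.\<close>

definition odd_range :: "int \<Rightarrow> int set" where "odd_range K = {u \<in> {-K..K}. odd u}"

lemma finite_odd_range: "finite (odd_range K)"
  by (rule finite_subset[of _ "{-K..K}"]) (auto simp: odd_range_def)

lemma odd_range_mod8: "u \<in> odd_range K \<Longrightarrow> K mod 8 = 1 \<Longrightarrow> K - u\<^sup>2 = 8 * ((K - u\<^sup>2) div 8)"
proof -
  assume "u \<in> odd_range K" "K mod 8 = 1"
  hence "u\<^sup>2 mod 8 = 1" using odd_sq_mod8 by (auto simp: odd_range_def)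
  thus ?thesis using \<open>K mod 8 = 1\<close> by presburger
qed

text \<open>The fibre sign is \<open>eps (d * e)\<close>, which agrees with \<open>eps e\<close> for
  odd \<open>d\<close>. Pairs with even \<open>d\<close> also lie in the fibres, but there
  \<open>chi d = 0\<close>.\<close>

lemma sum_sq8_products_fibres:
  assumes "K mod 8 = 1"
  shows "(\<Sum>(u, d, e)\<in>sq8_products K. eps e * chi d) = (\<Sum>u\<in>odd_range K. eps ((K - u\<^sup>2) div 8) * chi_sum ((K - u\<^sup>2) div 8))"
proof -
  let ?k = "\<lambda>u. (K - u\<^sup>2) div 8"
  let ?S = "Sigma (odd_range K) (\<lambda>u. {(d, e). d > 0 \<and> e > 0 \<and> d * e = ?k u})"
  have fin: "finite (odd_range K)" by (rule finite_odd_range)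
  have "(\<Sum>u\<in>odd_range K. eps (?k u) * chi_sum (?k u)) = (\<Sum>(u, y)\<in>?S. case y of (d, e) \<Rightarrow> eps (?k u) * chi d)"
    unfolding chi_sum_def by (subst sum.Sigma[symmetric])
      (use finite_divisor_pairs fin in \<open>auto simp: sum_distrib_left case_prod_unfold\<close>)
  also have "\<dots> = (\<Sum>(u, d, e)\<in>sq8_products K. eps e * chi d)"
  proof (rule sum.mono_neutral_cong_right)
    show "finite ?S" using fin finite_divisor_pairs by (intro finite_SigmaI) auto
    show "sq8_products K \<subseteq> ?S"
    proof
      fix x assume "x \<in> sq8_products K"
      then obtain z d e where x: "x = (z, d, e)" "d > 0" "e > 0" "z\<^sup>2 + 8 * (d * e) = K" by (auto simp: sq8_products_def)
      have "d * e > 0" using x by simp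
      hence "z\<^sup>2 \<le> K" using x(4) by linarith
      moreover have "odd K" using assms by presburger
      hence "odd z" using x(4) by auto
      ultimately have "z \<in> odd_range K" using sq_le_imp_mem_interval by (auto simp: odd_range_def)
      moreover have "d * e = ?k z" using x(4) by auto
      ultimately show "x \<in> ?S" using x by auto
    qed
    show "\<forall>x\<in>?S - sq8_products K. (case x of (u, y) \<Rightarrow> case y of (d, e) \<Rightarrow> eps (?k u) * chi d) = 0"
    proof
      fix x assume "x \<in> ?S - sq8_products K"
      then obtain u d e where x: "x = (u, d, e)" "u \<in> odd_range K" "d > 0" "e > 0" "d * e = ?k u" "x \<notin> sq8_products K" by auto
      hence "even d" using odd_range_mod8[OF x(2) assms] by (auto simp: sq8_products_def)
      thus "(case x of (u, y) \<Rightarrow> case y of (d, e) \<Rightarrow> eps (?k u) * chi d) = 0" by (simp add: x chi_even)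
    qed
    fix x assume "x \<in> sq8_products K"
    then obtain u d e where x: "x = (u, d, e)" "odd d" "K = u\<^sup>2 + 8 * (d * e)" by (auto simp: sq8_products_def)
    hence "eps (?k u) = eps e" by (simp add: eps_def)
    thus "(case x of (u, y) \<Rightarrow> case y of (d, e) \<Rightarrow> eps (?k u) * chi d) = (case x of (u, d, e) \<Rightarrow> eps e * chi d)"
      by (simp add: x)
  qed
  finally show ?thesis by simp
qed

section \<open>Signed sums over the corresponding ternary forms\<close>

definition sq4_triples :: "int \<Rightarrow> (int \<times> int \<times> int) set" where
  "sq4_triples K = {(x, y, z). x\<^sup>2 + y\<^sup>2 + 4 * z\<^sup>2 = K}"

lemma sq4_triples_fibres: "sq4_triples K = (\<lambda>(z, x, y). (x, y, z)) ` Sigma {-K..K} (\<lambda>z. two_squares (K - 4 * z\<^sup>2))" (is "?A = ?B")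
proof
  show "?A \<subseteq> ?B"
  proof
    fix w assume "w \<in> ?A"
    then obtain x y z where w: "w = (x, y, z)" "x\<^sup>2 + y\<^sup>2 + 4 * z\<^sup>2 = K" by (auto simp: sq4_triples_def)
    have "x\<^sup>2 \<ge> 0" "y\<^sup>2 \<ge> 0" "z\<^sup>2 \<ge> 0" by simp_all
    hence "z\<^sup>2 \<le> K" using w(2) by linarith
    hence "(z, x, y) \<in> Sigma {-K..K} (\<lambda>z. two_squares (K - 4 * z\<^sup>2))"
      using w(2) sq_le_imp_mem_interval[of z K] by (auto simp: two_squares_def)
    thus "w \<in> ?B" using w(1) by force
  qed
qed (auto simp: sq4_triples_def two_squares_def)

lemma finite_sq4_triples: "finite (sq4_triples K)"
  unfolding sq4_triples_fibres by (intro finite_imageI finite_SigmaI finite_two_squares) simp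

lemma sum_sq4_triples_fibres:
  "(\<Sum>(x, y, z)\<in>sq4_triples K. eps z) = (\<Sum>z\<in>{-K..K}. eps z * int (card (two_squares (K - 4 * z\<^sup>2))))"
proof -
  have "(\<Sum>z\<in>{-K..K}. eps z * int (card (two_squares (K - 4 * z\<^sup>2)))) =
     (\<Sum>(z, y)\<in>Sigma {-K..K} (\<lambda>z. two_squares (K - 4 * z\<^sup>2)). eps z)"
    by (subst sum.Sigma[symmetric]) (auto simp: finite_two_squares mult.commute)
  also have "\<dots> = (\<Sum>(x, y, z)\<in>sq4_triples K. eps z)"
    unfolding sq4_triples_fibres by (subst sum.reindex) (auto simp: inj_on_def case_prod_unfold)
  finally show ?thesis by simp
qed

definition sq8_triples :: "int \<Rightarrow> (int \<times> int \<times> int) set" where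
  "sq8_triples K = {(u, c, d). u\<^sup>2 + 8 * (c\<^sup>2 + d\<^sup>2) = K}"

lemma sum_sq8_triples_fibres:
  assumes "K mod 8 = 1"
  shows "(\<Sum>(u, c, d)\<in>sq8_triples K. eps (c + d)) =
    (\<Sum>u\<in>odd_range K. eps ((K - u\<^sup>2) div 8) * int (card (two_squares ((K - u\<^sup>2) div 8))))"
proof -
  let ?k = "\<lambda>u. (K - u\<^sup>2) div 8"
  have "(\<Sum>u\<in>odd_range K. eps (?k u) * int (card (two_squares (?k u)))) = (\<Sum>(u, y)\<in>Sigma (odd_range K) (\<lambda>u. two_squares (?k u)). eps (?k u))"
    by (subst sum.Sigma[symmetric]) (auto simp: finite_two_squares finite_odd_range mult.commute)
  also have "\<dots> = (\<Sum>(u, c, d)\<in>sq8_triples K. eps (c + d))"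
  proof (rule sum.cong)
    show "Sigma (odd_range K) (\<lambda>u. two_squares (?k u)) = sq8_triples K" (is "?A = ?B")
    proof
      show "?B \<subseteq> ?A"
      proof
        fix w assume "w \<in> ?B"
        then obtain u c d where w: "w = (u, c, d)" "u\<^sup>2 + 8 * (c\<^sup>2 + d\<^sup>2) = K" by (auto simp: sq8_triples_def)
        have "8 * (c\<^sup>2 + d\<^sup>2) \<ge> 0" by simp
        hence "u\<^sup>2 \<le> K" unfolding w(2)[symmetric] by simp
        moreover have "odd K" using assms by presburger
        hence "odd u" using w(2) by auto
        ultimately have "u \<in> odd_range K" using sq_le_imp_mem_interval by (auto simp: odd_range_def)
        moreover have "c\<^sup>2 + d\<^sup>2 = ?k u" using w(2) by auto
        ultimately show "w \<in> ?A" using w(1) by (auto simp: two_squares_def)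
      qed
      show "?A \<subseteq> ?B"
      proof
        fix w assume "w \<in> ?A"
        then obtain u c d where w: "w = (u, c, d)" "u \<in> odd_range K" "c\<^sup>2 + d\<^sup>2 = ?k u" by (auto simp: two_squares_def)
        have "u\<^sup>2 + 8 * ?k u = K" using odd_range_mod8[OF w(2) assms] by linarith
        thus "w \<in> ?B" unfolding w(1) sq8_triples_def w(3)[symmetric] by simp
      qed
    qed
    fix w assume "w \<in> sq8_triples K"
    then obtain u c d where w: "w = (u, c, d)" "u\<^sup>2 + 8 * (c\<^sup>2 + d\<^sup>2) = K" by (auto simp: sq8_triples_def)
    have "?k u = c\<^sup>2 + d\<^sup>2" using w(2) by auto
    thus "(case w of (u, y) \<Rightarrow> eps (?k u)) = (case w of (u, c, d) \<Rightarrow> eps (c + d))"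
      by (simp add: w(1) eps_def)
  qed
  finally show ?thesis by simp
qed

lemma sq4_triples_parity:
  assumes "(x, y, z) \<in> sq4_triples K" "odd K"
  shows "odd x \<longleftrightarrow> even y"
proof -
  have "odd (x\<^sup>2 + y\<^sup>2 + 4 * z\<^sup>2)" using assms by (auto simp: sq4_triples_def)
  thus ?thesis by auto
qed

text \<open>The residue of \<open>K\<close> mod 8 decides whether \<open>t\<close> and
  \<open>z\<close> have equal parity, and hence whether they can be swapped with a change of sign or
  rotated into \<open>c + d\<close> and \<open>c - d\<close>.\<close>

lemma sq4_triples_odd_half:
  assumes "(x, y, z) \<in> sq4_triples K" "odd K" "odd x"
  obtains t where "y = 2 * t" "x\<^sup>2 + 4 * (t\<^sup>2 + z\<^sup>2) = K" "K mod 8 = (if even (t + z) then 1 else 5)"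
proof -
  have "even y" using sq4_triples_parity assms by blast
  then obtain t where t: "y = 2 * t" by (elim evenE)
  have K: "K = x\<^sup>2 + 4 * (t\<^sup>2 + z\<^sup>2)" using assms(1) by (simp add: sq4_triples_def t power2_eq_square)
  have "x\<^sup>2 mod 8 = 1" by (rule odd_sq_mod8) fact
  moreover have "even (t + z) \<longleftrightarrow> even (t\<^sup>2 + z\<^sup>2)" by simp
  moreover have "(a + 4 * s) mod 8 = (if even s then 1 else 5)" if "a mod 8 = 1" for a s :: int
    using that by presburger
  ultimately have "K mod 8 = (if even (t + z) then 1 else 5)" unfolding K by presburger
  thus thesis using that t K by blast
qed

text \<open>Exactly one of \<open>x\<close> and \<open>y\<close> is odd, and swapping them preserves
  the weight.\<close>

lemma sum_sq4_triples_odd: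
  assumes "odd K"
  shows "(\<Sum>(x, y, z)\<in>sq4_triples K. eps z) = 2 * (\<Sum>(x, y, z)\<in>{(x, y, z)\<in>sq4_triples K. odd x}. eps z)"
proof -
  let ?w = "\<lambda>(x, y, z). eps z"
  define A where "A = {(x, y, z)\<in>sq4_triples K. odd x}"
  define B where "B = {(x, y, z)\<in>sq4_triples K. odd y}"
  have AB: "sq4_triples K = A \<union> B" "A \<inter> B = {}" using sq4_triples_parity[OF _ assms] by (auto simp: A_def B_def)
  have fin: "finite A" "finite B" using finite_sq4_triples[of K] AB(1) by auto
  have "sum ?w (sq4_triples K) = sum ?w A + sum ?w B"
    unfolding AB(1) using fin AB(2) by (rule sum.union_disjoint)
  also have "sum ?w B = sum ?w A"
    by (rule sum.reindex_bij_witness[of _ "\<lambda>(x, y, z). (y, x, z)" "\<lambda>(x, y, z). (y, x, z)"])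
      (auto simp: A_def B_def sq4_triples_def algebra_simps)
  finally show ?thesis by (simp add: A_def)
qed

text \<open>With \<open>y = 2 * t\<close>, the numbers \<open>t\<close> and \<open>z\<close> have
  opposite parity, so exchanging them flips \<open>eps z\<close>.\<close>

lemma sum_sq4_triples_mod8_5:
  assumes "K mod 8 = 5"
  shows "(\<Sum>(x, y, z)\<in>sq4_triples K. eps z) = 0"
proof -
  have K: "odd K" using assms by presburger
  have "(\<Sum>(x, y, z)\<in>{(x, y, z)\<in>sq4_triples K. odd x}. eps z) = 0"
  proof (rule sum_involution_0[where g = "\<lambda>(x, y, z). (x, 2 * z, y div 2)"])
    fix w assume "w \<in> {(x, y, z)\<in>sq4_triples K. odd x}"
    then obtain x y z where w: "w = (x, y, z)" "(x, y, z) \<in> sq4_triples K" "odd x" by auto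
    obtain t where t: "y = 2 * t" "x\<^sup>2 + 4 * (t\<^sup>2 + z\<^sup>2) = K" "K mod 8 = (if even (t + z) then 1 else 5)"
      using sq4_triples_odd_half[OF w(2) K w(3)] by blast
    have tz: "odd (t + z)" using t(3) assms by (auto split: if_splits)
    show "(case w of (x, y, z) \<Rightarrow> (x, 2 * z, y div 2)) \<in> {(x, y, z)\<in>sq4_triples K. odd x}"
      using w t by (auto simp: sq4_triples_def power2_eq_square)
    show "(case case w of (x, y, z) \<Rightarrow> (x, 2 * z, y div 2) of (x, y, z) \<Rightarrow> (x, 2 * z, y div 2)) = w"
      using w t by simp
    show "(case case w of (x, y, z) \<Rightarrow> (x, 2 * z, y div 2) of (x, y, z) \<Rightarrow> eps z) = - (case w of (x, y, z) \<Rightarrow> eps z)"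
      using w t tz by (auto simp: eps_def)
  qed
  thus ?thesis using sum_sq4_triples_odd[OF K] by simp
qed

text \<open>With \<open>y = 2 * t\<close>, the numbers \<open>t\<close> and \<open>z\<close> have
  equal parity. Writing \<open>t = c + d\<close> and \<open>z = c - d\<close> gives
  \<open>t\<^sup>2 + z\<^sup>2 = 2 * (c\<^sup>2 + d\<^sup>2)\<close> and
  \<open>eps z = eps (c + d)\<close>.\<close>

lemma sum_sq4_triples_mod8_1:
  assumes "K mod 8 = 1"
  shows "(\<Sum>(x, y, z)\<in>sq4_triples K. eps z) = 2 * (\<Sum>(u, c, d)\<in>sq8_triples K. eps (c + d))"
proof -
  have K: "odd K" using assms by presburger
  have "(\<Sum>(x, y, z)\<in>{(x, y, z)\<in>sq4_triples K. odd x}. eps z) = (\<Sum>(u, c, d)\<in>sq8_triples K. eps (c + d))"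
  proof (rule sum.reindex_bij_witness[of _ "\<lambda>(u, c, d). (u, 2 * (c + d), c - d)"
      "\<lambda>(x, y, z). (x, (y div 2 + z) div 2, (y div 2 - z) div 2)"])
    fix w assume "w \<in> {(x, y, z)\<in>sq4_triples K. odd x}"
    then obtain x y z where w: "w = (x, y, z)" "(x, y, z) \<in> sq4_triples K" "odd x" by auto
    obtain t where t: "y = 2 * t" "x\<^sup>2 + 4 * (t\<^sup>2 + z\<^sup>2) = K" "K mod 8 = (if even (t + z) then 1 else 5)"
      using sq4_triples_odd_half[OF w(2) K w(3)] by blast
    have "even (t + z)" using t(3) assms by (auto split: if_splits)
    then obtain c where "t + z = 2 * c" by (elim evenE)
    hence tz: "t = 2 * c - z" by simp
    define d where "d = c - z"
    have z: "z = c - d" and t': "t = c + d" by (auto simp: d_def tz)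
    have g: "(case w of (x, y, z) \<Rightarrow> (x, (y div 2 + z) div 2, (y div 2 - z) div 2)) = (x, c, d)"
      by (simp add: w t t' z)
    show "(case w of (x, y, z) \<Rightarrow> (x, (y div 2 + z) div 2, (y div 2 - z) div 2)) \<in> sq8_triples K"
      unfolding g using t(2) by (simp add: sq8_triples_def t' z power2_eq_square algebra_simps)
    show "(case case w of (x, y, z) \<Rightarrow> (x, (y div 2 + z) div 2, (y div 2 - z) div 2) of
        (u, c, d) \<Rightarrow> (u, 2 * (c + d), c - d)) = w"
      unfolding g by (simp add: w t t' z)
    show "(case case w of (x, y, z) \<Rightarrow> (x, (y div 2 + z) div 2, (y div 2 - z) div 2) of
        (u, c, d) \<Rightarrow> eps (c + d)) = (case w of (x, y, z) \<Rightarrow> eps z)"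
      unfolding g by (simp add: w z eps_add eps_diff)
  next
    fix w assume "w \<in> sq8_triples K"
    then obtain u c d where w: "w = (u, c, d)" "u\<^sup>2 + 8 * (c\<^sup>2 + d\<^sup>2) = K" by (auto simp: sq8_triples_def)
    have "odd u" using w(2) K by auto
    thus "(case w of (u, c, d) \<Rightarrow> (u, 2 * (c + d), c - d)) \<in> {(x, y, z)\<in>sq4_triples K. odd x}"
      using w(2) by (auto simp: w(1) sq4_triples_def power2_eq_square algebra_simps)
  qed auto
  thus ?thesis using sum_sq4_triples_odd[OF K] by simp
qed

section \<open>Comparison of the two recursions and Jacobi's two-square theorem\<close>

lemma sum_odd_range_square:
  assumes "K mod 8 = 1"
  shows "(\<Sum>u\<in>odd_range K. of_bool (u\<^sup>2 = K)) = (if \<exists>M. K = M\<^sup>2 then 2 else 0 :: int)"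
proof -
  have odd: "odd u" if "u\<^sup>2 = K" for u
  proof -
    have "odd K" using assms by presburger
    thus ?thesis using that by auto
  qed
  have "(\<Sum>u\<in>odd_range K. of_bool (u\<^sup>2 = K)) = int (card (odd_range K \<inter> {u. u\<^sup>2 = K}))"
    using finite_odd_range[of K] by (simp add: sum_of_bool_eq)
  also have "odd_range K \<inter> {u. u\<^sup>2 = K} = {u. u\<^sup>2 = K}"
    using odd sq_le_imp_mem_interval[of _ K] by (auto simp: odd_range_def)
  also have "int (card {u. u\<^sup>2 = K}) = (if \<exists>M. K = M\<^sup>2 then 2 else 0)"
  proof (cases "\<exists>M. K = M\<^sup>2")
    case True
    then obtain M where M: "K = M\<^sup>2" by blast
    have "{u. u\<^sup>2 = K} = {M, - M}" by (auto simp: M power2_eq_iff)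
    moreover have "M \<noteq> - M" using odd[of M] M by auto
    ultimately show ?thesis using True by simp
  next
    case False
    hence "{u. u\<^sup>2 = K} = {}" by auto
    thus ?thesis using False by simp
  qed
  finally show ?thesis .
qed

text \<open>Both sides vanish for nonsquare \<open>K\<close> and equal \<open>chi M * M\<close> for
  \<open>K = M\<^sup>2\<close> with \<open>M > 0\<close>. This is the divisor-sum counterpart of
  \<open>sum_sq4_triples_mod8_1\<close>; the extra 1 matches the representation of 0 by two
  squares.\<close>

lemma sum_sq4_products_eq_sum_sq8_products:
  assumes "K mod 8 = 1"
  shows "(\<Sum>(z, d, e)\<in>sq4_products K. eps z * chi d) =
    2 * (\<Sum>(u, d, e)\<in>sq8_products K. eps e * chi d) + of_bool (\<exists>M. K = M\<^sup>2)"
proof (cases "\<exists>M. K = M\<^sup>2")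
  case True
  then obtain M0 where M0: "K = M0\<^sup>2" by blast
  define M where "M = \<bar>M0\<bar>"
  have M: "K = M\<^sup>2" using M0 by (simp add: M_def)
  have "odd K" using assms by presburger
  hence "odd M" using M by auto
  moreover from this have "M > 0" by (auto simp: M_def)
  ultimately show ?thesis using sum_sq4_products_square[of M] sum_sq8_products_square[of M] True by (simp add: M)
next
  case False
  hence ns: "K \<noteq> M\<^sup>2" for M by blast
  have "K mod 4 = 1" using assms by presburger
  thus ?thesis using sum_sq4_products_nonsquare[of K] sum_sq8_products_nonsquare[of K] ns assms False by simp
qed

text \<open>
  For \<open>n \<equiv> 1 (mod 4)\<close> the numbers of representations and the divisor sums satisfy the same recursion:
  \<open>x\<^sup>2 + y\<^sup>2 + 4 z\<^sup>2 = n\<close> reduces to \<open>u\<^sup>2 + 8 (c\<^sup>2 + d\<^sup>2) = n\<close>, in which \<open>c\<^sup>2 + d\<^sup>2 < n\<close>.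
\<close>

lemma card_two_squares: "n > 0 \<Longrightarrow> int (card (two_squares n)) = 4 * chi_sum n"
proof (induction "nat n" arbitrary: n rule: less_induct)
  case less
  \<comment> \<open>For negative \<open>k\<close> both sides are 0. The value \<open>k = 0\<close>
    is excluded because 0 has one representation while \<open>chi_sum 0 = 0\<close>.\<close>
  have IH: "int (card (two_squares k)) = 4 * chi_sum k" if "k < n" "k \<noteq> 0" for k
  proof (cases "k > 0")
    case True
    thus ?thesis using less(1)[of k] that by simp
  next
    case False
    thus ?thesis using that by (simp add: two_squares_neg chi_sum_nonpos)
  qed
  have "even n \<or> n mod 4 = 3 \<or> n mod 8 = 1 \<or> n mod 8 = 5" by presburger
  then consider "even n" | "n mod 4 = 3" | "n mod 8 = 1 \<or> n mod 8 = 5" by blast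
  thus ?case
  proof cases
    case 1
    then obtain k where k: "n = 2 * k" by (elim evenE)
    thus ?thesis using IH[of k] less(2) by (simp add: card_two_squares_double chi_sum_double)
  next
    case 2
    thus ?thesis by (simp add: two_squares_mod4_3 chi_sum_mod4_3)
  next
    case 3
    have sq4_triples: "(\<Sum>(x, y, z)\<in>sq4_triples n. eps z) = 4 * (\<Sum>(z, d, e)\<in>sq4_products n. eps z * chi d)"
    proof (cases "n mod 8 = 5")
      case True
      thus ?thesis using sum_sq4_triples_mod8_5 sum_sq4_products_mod8_5 by simp
    next
      case False
      hence n: "n mod 8 = 1" using 3 by blast
      \<comment> \<open>The correction term accounts for the single representation of 0 in the fibre
        over \<open>u\<^sup>2 = n\<close>.\<close>
      have k: "int (card (two_squares ((n - u\<^sup>2) div 8))) = 4 * chi_sum ((n - u\<^sup>2) div 8) + of_bool (u\<^sup>2 = n)"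
        if "u \<in> odd_range n" for u
      proof (cases "u\<^sup>2 = n")
        case True
        thus ?thesis by (simp add: two_squares_0 chi_sum_nonpos)
      next
        case False
        have "u\<^sup>2 \<ge> 0" by simp
        hence "(n - u\<^sup>2) div 8 < n" "(n - u\<^sup>2) div 8 \<noteq> 0" using odd_range_mod8[OF that n] False less(2) by linarith+
        thus ?thesis using IH False by simp
      qed
      have "(\<Sum>(u, c, d)\<in>sq8_triples n. eps (c + d)) =
        (\<Sum>u\<in>odd_range n. 4 * (eps ((n - u\<^sup>2) div 8) * chi_sum ((n - u\<^sup>2) div 8)) + of_bool (u\<^sup>2 = n))"
        unfolding sum_sq8_triples_fibres[OF n]
        by (rule sum.cong) (auto simp: k algebra_simps eps_def)
      also have "\<dots> = 4 * (\<Sum>(u, d, e)\<in>sq8_products n. eps e * chi d) + 2 * of_bool (\<exists>M. n = M\<^sup>2)"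
        unfolding sum.distrib sum_odd_range_square[OF n] sum_sq8_products_fibres[OF n] by (simp add: sum_distrib_left)
      finally show ?thesis unfolding sum_sq4_triples_mod8_1[OF n] sum_sq4_products_eq_sum_sq8_products[OF n] by simp
    qed
    have "odd n" using 3 by presburger
    \<comment> \<open>The fibre over \<open>z = 0\<close> involves \<open>n\<close> itself. All
      other fibres agree by induction, so equality of the totals settles this one.\<close>
    have split: "(\<Sum>z\<in>{-n..n}. f z) = f 0 + (\<Sum>z\<in>{-n..n}-{0}. f z)" for f :: "int \<Rightarrow> int"
      using less(2) by (intro sum.remove) auto
    have "(\<Sum>z\<in>{-n..n}-{0}. eps z * int (card (two_squares (n - 4 * z\<^sup>2)))) =
        (\<Sum>z\<in>{-n..n}-{0}. 4 * (eps z * chi_sum (n - 4 * z\<^sup>2)))"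
    proof (rule sum.cong)
      fix z assume "z \<in> {-n..n} - {0}"
      hence "z\<^sup>2 > 0" by simp
      moreover have "n - 4 * z\<^sup>2 \<noteq> 0"
      proof
        assume "n - 4 * z\<^sup>2 = 0"
        hence "n = 2 * (2 * z\<^sup>2)" by simp
        thus False using \<open>odd n\<close> by (metis dvd_triv_left)
      qed
      ultimately show "eps z * int (card (two_squares (n - 4 * z\<^sup>2))) = 4 * (eps z * chi_sum (n - 4 * z\<^sup>2))"
        using IH[of "n - 4 * z\<^sup>2"] by simp
    qed simp
    thus ?thesis
      using sq4_triples unfolding sum_sq4_triples_fibres sum_sq4_products_fibres split
      by (simp add: sum_distrib_left eps_def)
  qed
qed

text \<open>The two-square theorem applies in every fibre, since \<open>K - 4 * z\<^sup>2\<close> is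
  odd and hence nonzero. The sum becomes 4 times the vanishing one over
  \<open>sq4_products K\<close>.\<close>

lemma sum_sq4_triples_nonsquare:
  assumes "K mod 4 = 1" "\<And>M. K \<noteq> M\<^sup>2"
  shows "(\<Sum>(x, y, z)\<in>sq4_triples K. eps z) = 0"
proof -
  have "odd K" using assms(1) by presburger
  have "int (card (two_squares (K - 4 * z\<^sup>2))) = 4 * chi_sum (K - 4 * z\<^sup>2)" for z
  proof -
    have "K - 4 * z\<^sup>2 \<noteq> 0"
    proof
      assume "K - 4 * z\<^sup>2 = 0"
      hence "K = 2 * (2 * z\<^sup>2)" by simp
      thus False using \<open>odd K\<close> by (metis dvd_triv_left)
    qed
    thus ?thesis using card_two_squares[of "K - 4 * z\<^sup>2"] two_squares_neg[of "K - 4 * z\<^sup>2"] chi_sum_nonpos[of "K - 4 * z\<^sup>2"] by force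
  qed
  hence "(\<Sum>(x, y, z)\<in>sq4_triples K. eps z) = (\<Sum>z\<in>{-K..K}. 4 * (eps z * chi_sum (K - 4 * z\<^sup>2)))"
    unfolding sum_sq4_triples_fibres by (intro sum.cong) auto
  also have "\<dots> = 4 * (\<Sum>(z, d, e)\<in>sq4_products K. eps z * chi d)"
    unfolding sum_sq4_products_fibres by (simp add: sum_distrib_left)
  also have "\<dots> = 0" using sum_sq4_products_nonsquare[OF assms] by simp
  finally show ?thesis .
qed

subsection \<open>The quaternary form\<close>

lemma square_mod8: "(x::int)\<^sup>2 mod 8 = 0 \<and> even x \<or> x\<^sup>2 mod 8 = 4 \<and> even x \<or> x\<^sup>2 mod 8 = 1 \<and> odd x"
proof (cases "even x")
  case True
  then obtain k where "x = 2 * k" by (elim evenE)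
  hence "x\<^sup>2 = 4 * k\<^sup>2" by (simp add: power2_eq_square)
  moreover have "(4 * s) mod 8 = 0 \<or> (4 * s) mod 8 = 4" for s :: int by presburger
  ultimately show ?thesis using True by metis
qed (simp add: odd_sq_mod8)

lemma square_mod4: "(x::int)\<^sup>2 mod 4 = 0 \<and> even x \<or> x\<^sup>2 mod 4 = 1 \<and> odd x"
proof -
  have "x\<^sup>2 mod 4 = (x\<^sup>2 mod 8) mod 4" by (simp add: mod_mod_cancel)
  thus ?thesis using square_mod8[of x] by auto
qed

lemma mod_add3_eq: "(a + b + c) mod k = (a mod k + b mod k + c mod k) mod (k :: int)"
  by (metis mod_add_eq mod_add_left_eq)

definition quad_solutions :: "nat \<Rightarrow> nat \<Rightarrow> (int \<times> int \<times> int \<times> int) set" where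
  "quad_solutions m n = {(x, y, z, w). x\<^sup>2 + y\<^sup>2 + 8 * z\<^sup>2 + int m * w\<^sup>2 = 8 * int n + 10 + int m}"

text \<open>In the first case \<open>x\<^sup>2 + y\<^sup>2 + w\<^sup>2 \<equiv> 3\<close> mod 4,
  which needs three odd squares. In the second
  \<open>x\<^sup>2 + y\<^sup>2 + 4 * w\<^sup>2 \<equiv> 6\<close> mod 8, which is possible only as 1
  + 1 + 4.\<close>

lemma quad_solutions_odd:
  assumes "[m = 1] (mod 4) \<or> [m = 4] (mod 8)" "(x, y, z, w) \<in> quad_solutions m n"
  shows "odd x" "odd y" "odd w"
proof -
  have eq: "x\<^sup>2 + y\<^sup>2 + 8 * z\<^sup>2 + int m * w\<^sup>2 = 8 * int n + 10 + int m"
    using assms(2) by (simp add: quad_solutions_def)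
  have "odd x \<and> odd y \<and> odd w"
    using assms(1)
  proof
    assume "[m = 1] (mod 4)"
    hence "m mod 4 = 1" by (simp add: cong_def)
    hence "int m = 4 * int (m div 4) + 1" by presburger
    then obtain q where "int m = 4 * q + 1" by blast
    hence "x\<^sup>2 + y\<^sup>2 + 8 * z\<^sup>2 + w\<^sup>2 + 4 * (q * w\<^sup>2) = 8 * int n + 11 + 4 * q"
      using eq by (simp add: algebra_simps)
    hence "x\<^sup>2 + y\<^sup>2 + w\<^sup>2 = 3 + 4 * (2 * int n + 2 + q - 2 * z\<^sup>2 - q * w\<^sup>2)" by simp
    hence "(x\<^sup>2 + y\<^sup>2 + w\<^sup>2) mod 4 = 3" by (simp only: mod_mult_self2) simp
    moreover have "(x\<^sup>2 + y\<^sup>2 + w\<^sup>2) mod 4 = (x\<^sup>2 mod 4 + y\<^sup>2 mod 4 + w\<^sup>2 mod 4) mod 4"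
      by (rule mod_add3_eq)
    ultimately show ?thesis
      using square_mod4[of x] square_mod4[of y] square_mod4[of w] by auto
  next
    assume "[m = 4] (mod 8)"
    hence "m mod 8 = 4" by (simp add: cong_def)
    hence "int m = 8 * int (m div 8) + 4" by presburger
    then obtain q where "int m = 8 * q + 4" by blast
    hence "x\<^sup>2 + y\<^sup>2 + 8 * z\<^sup>2 + 4 * w\<^sup>2 + 8 * (q * w\<^sup>2) = 8 * int n + 14 + 8 * q"
      using eq by (simp add: algebra_simps)
    hence "x\<^sup>2 + y\<^sup>2 + 4 * w\<^sup>2 = 6 + 8 * (int n + 1 + q - z\<^sup>2 - q * w\<^sup>2)" by simp
    hence "(x\<^sup>2 + y\<^sup>2 + 4 * w\<^sup>2) mod 8 = 6" by (simp only: mod_mult_self2) simp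
    moreover have "(x\<^sup>2 + y\<^sup>2 + 4 * w\<^sup>2) mod 8 = (x\<^sup>2 mod 8 + y\<^sup>2 mod 8 + 4 * w\<^sup>2 mod 8) mod 8"
      by (rule mod_add3_eq)
    moreover have "(4 * s) mod 8 = (if even s then 0 else 4)" for s :: int by presburger
    hence "4 * w\<^sup>2 mod 8 = (if even w then 0 else 4)" by simp
    ultimately show ?thesis
      using square_mod8[of x] square_mod8[of y] by (auto split: if_splits)
  qed
  thus "odd x" "odd y" "odd w" by auto
qed

definition ternary_fibre :: "int \<Rightarrow> (int \<times> int \<times> int) set" where
  "ternary_fibre L = {(x, y, z). x\<^sup>2 + y\<^sup>2 + 8 * z\<^sup>2 = L}"

lemma finite_ternary_fibre: "finite (ternary_fibre L)"
proof (rule finite_subset)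
  show "ternary_fibre L \<subseteq> {-L..L} \<times> {-L..L} \<times> {-L..L}"
  proof
    fix v assume "v \<in> ternary_fibre L"
    then obtain x y z where v: "v = (x, y, z)" "x\<^sup>2 + y\<^sup>2 + 8 * z\<^sup>2 = L" by (auto simp: ternary_fibre_def)
    have "x\<^sup>2 \<ge> 0" "y\<^sup>2 \<ge> 0" "z\<^sup>2 \<ge> 0" by simp_all
    hence "x\<^sup>2 \<le> L" "y\<^sup>2 \<le> L" "z\<^sup>2 \<le> L" using v(2) by linarith+
    thus "v \<in> {-L..L} \<times> {-L..L} \<times> {-L..L}"
      using v(1) sq_le_imp_mem_interval by blast
  qed
qed auto

lemma sum_ternary_fibre_eq_sum_sq4_triples:
  assumes "odd K"
  shows "(\<Sum>(x, y, z)\<in>ternary_fibre (2 * K). eps z) = (\<Sum>(u, v, z)\<in>sq4_triples K. eps z)"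
proof (rule sum.reindex_bij_witness[of _ "\<lambda>(u, v, z). (u + v, u - v, z)"
      "\<lambda>(x, y, z). ((x + y) div 2, (x - y) div 2, z)"])
  fix a assume "a \<in> ternary_fibre (2 * K)"
  then obtain x y z where a: "a = (x, y, z)" "x\<^sup>2 + y\<^sup>2 + 8 * z\<^sup>2 = 2 * K" by (auto simp: ternary_fibre_def)
  have "even (x\<^sup>2 + y\<^sup>2 + 8 * z\<^sup>2)" using a(2) by simp
  hence "even (x - y)" by simp
  then obtain v where "x - y = 2 * v" by (elim evenE)
  hence v: "x = y + 2 * v" by simp
  define u where "u = y + v"
  have xy: "x = u + v" "y = u - v" using v by (auto simp: u_def)
  have g: "(case a of (x, y, z) \<Rightarrow> ((x + y) div 2, (x - y) div 2, z)) = (u, v, z)"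
    by (simp add: a(1) xy)
  show "(case a of (x, y, z) \<Rightarrow> ((x + y) div 2, (x - y) div 2, z)) \<in> sq4_triples K"
    unfolding g using a(2) by (simp add: sq4_triples_def xy power2_eq_square algebra_simps)
  show "(case case a of (x, y, z) \<Rightarrow> ((x + y) div 2, (x - y) div 2, z) of (u, v, z) \<Rightarrow> (u + v, u - v, z)) = a"
    unfolding g by (simp add: a(1) xy)
  show "(case case a of (x, y, z) \<Rightarrow> ((x + y) div 2, (x - y) div 2, z) of (u, v, z) \<Rightarrow> eps z) =
      (case a of (x, y, z) \<Rightarrow> eps z)"
    unfolding g by (simp add: a(1))
qed (auto simp: sq4_triples_def ternary_fibre_def power2_eq_square algebra_simps)

lemma quad_solutions_fibres:
  assumes "m > 0"
  shows "quad_solutions m n = (\<lambda>(w, x, y, z). (x, y, z, w)) `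
    Sigma {- (8 * int n + 10 + int m)..8 * int n + 10 + int m} (\<lambda>w. ternary_fibre (8 * int n + 10 + int m - int m * w\<^sup>2))"
    (is "?A = ?f ` ?B")
proof
  show "?A \<subseteq> ?f ` ?B"
  proof
    fix v assume "v \<in> ?A"
    then obtain x y z w where v: "v = (x, y, z, w)"
      and eq: "x\<^sup>2 + y\<^sup>2 + 8 * z\<^sup>2 + int m * w\<^sup>2 = 8 * int n + 10 + int m" by (auto simp: quad_solutions_def)
    have "1 * w\<^sup>2 \<le> int m * w\<^sup>2" using assms by (intro mult_right_mono) auto
    moreover have "x\<^sup>2 \<ge> 0" "y\<^sup>2 \<ge> 0" "z\<^sup>2 \<ge> 0" by simp_all
    ultimately have "w\<^sup>2 \<le> 8 * int n + 10 + int m" using eq by linarith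
    from sq_le_imp_mem_interval[OF this] have "(w, x, y, z) \<in> ?B" using eq by (auto simp: ternary_fibre_def)
    thus "v \<in> ?f ` ?B" using v by force
  qed
qed (auto simp: quad_solutions_def ternary_fibre_def)

lemma finite_quad_solutions: "m > 0 \<Longrightarrow> finite (quad_solutions m n)"
  unfolding quad_solutions_fibres by (intro finite_imageI finite_SigmaI finite_ternary_fibre) simp

lemma sum_quad_solutions_eq_0:
  assumes "m > 0" "[m = 1] (mod 4) \<or> [m = 4] (mod 8)"
    and p: "p dvd m" "Legendre (4 * int n + 5) (int p) = -1"
  shows "(\<Sum>(x, y, z, w)\<in>quad_solutions m n. eps z) = 0"
proof -
  define L where "L = 8 * int n + 10 + int m"
  have 0: "(\<Sum>(x, y, z)\<in>ternary_fibre (L - int m * w\<^sup>2). eps z) = 0" for w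
  proof (cases "even w")
    case True
    have "ternary_fibre (L - int m * w\<^sup>2) = {}"
    proof (rule ccontr)
      assume "ternary_fibre (L - int m * w\<^sup>2) \<noteq> {}"
      then obtain x y z where "(x, y, z) \<in> ternary_fibre (L - int m * w\<^sup>2)" by auto
      hence "(x, y, z, w) \<in> quad_solutions m n" by (simp add: ternary_fibre_def quad_solutions_def L_def)
      thus False using quad_solutions_odd[OF assms(2)] True by blast
    qed
    thus ?thesis by simp
  next
    case False
    hence "w\<^sup>2 mod 8 = 1" by (rule odd_sq_mod8)
    hence "w\<^sup>2 = 8 * (w\<^sup>2 div 8) + 1" by presburger
    then obtain j where j: "w\<^sup>2 = 8 * j + 1" by blast
    \<comment> \<open>Half of \<open>L - int m * w\<^sup>2\<close>, where
      \<open>w\<^sup>2 = 8 * j + 1\<close> cancels the summand \<open>int m\<close> of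
      \<open>L\<close>.\<close>
    define K where "K = 4 * int n + 5 - 4 * (int m * j)"
    have L: "L - int m * w\<^sup>2 = 2 * K" by (simp add: L_def K_def j algebra_simps)
    have K: "K mod 4 = 1" unfolding K_def by presburger
    \<comment> \<open>As \<open>p\<close> divides \<open>m\<close>,
      \<open>K \<equiv> 4 * n + 5\<close> mod \<open>p\<close>, so a square \<open>K\<close> would
      contradict the Legendre symbol.\<close>
    have "K \<noteq> M\<^sup>2" for M
    proof
      assume "K = M\<^sup>2"
      moreover have "int p dvd K - (4 * int n + 5)" using p(1) by (simp add: K_def)
      ultimately have "[M\<^sup>2 = 4 * int n + 5] (mod int p)" by (simp add: cong_iff_dvd_diff)
      hence "QuadRes (int p) (4 * int n + 5)" by (auto simp: QuadRes_def)
      thus False using p(2) by (auto simp: Legendre_def split: if_splits)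
    qed
    hence "(\<Sum>(x, y, z)\<in>sq4_triples K. eps z) = 0" using sum_sq4_triples_nonsquare K by blast
    moreover have "odd K" using K by presburger
    ultimately show ?thesis unfolding L using sum_ternary_fibre_eq_sum_sq4_triples by simp
  qed
  have "(\<Sum>(x, y, z, w)\<in>quad_solutions m n. eps z) = (\<Sum>(w, x, y, z)\<in>Sigma {-L..L} (\<lambda>w. ternary_fibre (L - int m * w\<^sup>2)). eps z)"
    unfolding quad_solutions_fibres[OF assms(1)] L_def[symmetric]
    by (subst sum.reindex) (auto simp: inj_on_def case_prod_unfold)
  also have "\<dots> = (\<Sum>w\<in>{-L..L}. \<Sum>(x, y, z)\<in>ternary_fibre (L - int m * w\<^sup>2). eps z)"
    by (rule sum.Sigma[symmetric]) (auto simp: finite_ternary_fibre)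
  also have "\<dots> = 0" using 0 by simp
  finally show ?thesis .
qed

section \<open>Translation to the counts \<open>N\<close> and \<open>t\<close>\<close>

lemma length_4: "length xs = 4 \<longleftrightarrow> (\<exists>a b c d. xs = [a, b, c, d])"
  by (auto simp: eval_nat_numeral length_Suc_conv)

lemma N_eq_card_quad_solutions: "N [1, 1, 8, m] (8 * n + 10 + m) = card (quad_solutions m n)"
proof -
  define A where "A = {xs :: int list. length xs = length [1, 1, 8, m] \<and>
     int (8 * n + 10 + m) = (\<Sum>i<length [1, 1, 8, m]. int ([1, 1, 8, m] ! i) * (xs ! i)\<^sup>2)}"
  have mem: "[x, y, z, w] \<in> A \<longleftrightarrow> (x, y, z, w) \<in> quad_solutions m n" for x y z w
    by (auto simp: A_def quad_solutions_def eval_nat_numeral)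
  have "A = (\<lambda>(x, y, z, w). [x, y, z, w]) ` quad_solutions m n"
  proof (intro Set.set_eqI iffI)
    fix xs assume xs: "xs \<in> A"
    then obtain x y z w where "xs = [x, y, z, w]" using length_4[of xs] by (auto simp: A_def)
    thus "xs \<in> (\<lambda>(x, y, z, w). [x, y, z, w]) ` quad_solutions m n" using xs mem by force
  qed (auto simp: mem)
  moreover have "inj_on (\<lambda>(x, y, z, w). [x, y, z, w]) (quad_solutions m n)" by (auto simp: inj_on_def)
  ultimately have "card A = card (quad_solutions m n)" by (simp add: card_image)
  thus ?thesis by (simp only: N_def A_def)
qed

text \<open>Multiplying by 8 completes the squares through \<open>x = 2 * a - 1\<close>. The
  constants subtracted add up to \<open>1 + 1 + 8 + m\<close>, which explains the shift
  \<open>10 + m\<close>.\<close>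

lemma t_eq_card_quad_solutions:
  "t [1, 1, 8, m] n = card {(x, y, z, w) \<in> quad_solutions m n. odd x \<and> odd y \<and> odd z \<and> odd w}" (is "_ = card ?B")
proof -
  have tri: "8 * (a * (a - 1) div 2) = (2 * a - 1)\<^sup>2 - 1" for a :: int
  proof -
    have "even (a * (a - 1))" by simp
    then obtain k where "a * (a - 1) = 2 * k" by (elim evenE)
    thus ?thesis by (simp add: power2_eq_square algebra_simps)
  qed
  define A where "A = {xs :: int list. length xs = length [1, 1, 8, m] \<and>
     int n = (\<Sum>i<length [1, 1, 8, m]. int ([1, 1, 8, m] ! i) * ((xs ! i) * (xs ! i - 1) div 2))}"
  have mem: "[a, b, c, d] \<in> A \<longleftrightarrow> (2 * a - 1, 2 * b - 1, 2 * c - 1, 2 * d - 1) \<in> quad_solutions m n" for a b c d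
  proof -
    have "[a, b, c, d] \<in> A \<longleftrightarrow> int n = a * (a - 1) div 2 + b * (b - 1) div 2 + 8 * (c * (c - 1) div 2) + int m * (d * (d - 1) div 2)"
      by (auto simp: A_def eval_nat_numeral)
    also have "\<dots> \<longleftrightarrow> 8 * int n = 8 * (a * (a - 1) div 2) + 8 * (b * (b - 1) div 2) + 8 * (8 * (c * (c - 1) div 2)) + int m * (8 * (d * (d - 1) div 2))"
      by linarith
    also have "\<dots> \<longleftrightarrow> (2 * a - 1, 2 * b - 1, 2 * c - 1, 2 * d - 1) \<in> quad_solutions m n"
      unfolding tri quad_solutions_def by (auto simp: algebra_simps)
    finally show ?thesis .
  qed
  have half: "2 * ((x + 1) div 2) - 1 = x" if "odd x" for x :: int using that by presburger
  have "A = (\<lambda>(x, y, z, w). [(x + 1) div 2, (y + 1) div 2, (z + 1) div 2, (w + 1) div 2]) ` ?B"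
    (is "_ = ?f ` _")
  proof (intro Set.set_eqI iffI)
    fix xs assume xs: "xs \<in> A"
    then obtain a b c d where abcd: "xs = [a, b, c, d]" using length_4[of xs] by (auto simp: A_def)
    have "(2 * a - 1, 2 * b - 1, 2 * c - 1, 2 * d - 1) \<in> ?B" using xs by (simp add: abcd mem)
    moreover have "xs = ?f (2 * a - 1, 2 * b - 1, 2 * c - 1, 2 * d - 1)" by (simp add: abcd)
    ultimately show "xs \<in> ?f ` ?B" by blast
  next
    fix xs assume "xs \<in> ?f ` ?B"
    then obtain x y z w where h: "xs = ?f (x, y, z, w)" "(x, y, z, w) \<in> quad_solutions m n"
      "odd x" "odd y" "odd z" "odd w" by auto
    show "xs \<in> A" using h(2) unfolding h(1) prod.case mem by (simp only: half[OF h(3)] half[OF h(4)] half[OF h(5)] half[OF h(6)])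
  qed
  moreover have "inj_on ?f ?B"
    by (rule inj_on_inverseI[of _ "\<lambda>xs. (2 * xs ! 0 - 1, 2 * xs ! 1 - 1, 2 * xs ! 2 - 1, 2 * xs ! 3 - 1)"])
      (clarsimp simp: half simp del: odd_succ_div_two odd_two_times_div_two_succ)
  ultimately have "card A = card ?B" by (simp only: card_image)
  thus ?thesis by (simp only: t_def A_def)
qed

theorem theorem2p3:
  fixes m n :: nat
  assumes "m > 0" and "n > 0"
    and "[m = 1] (mod 4) \<or> [m = 4] (mod 8)"
    and "\<exists>p::nat. prime p \<and> odd p \<and> p dvd m \<and> Legendre (4 * int n + 5) (int p) = -1"
  shows "real (t [1, 1, 8, m] n) = 1 / 2 * real (N [1, 1, 8, m] (8 * n + 10 + m))"
proof -
  define A where "A = {(x, y, z, w) \<in> quad_solutions m n. odd z}"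
  define B where "B = {(x, y, z, w) \<in> quad_solutions m n. even z}"
  have AB: "quad_solutions m n = A \<union> B" "A \<inter> B = {}" by (auto simp: A_def B_def)
  have fin: "finite A" "finite B" using finite_quad_solutions[OF assms(1), of n] AB(1) by auto
  have "{(x, y, z, w) \<in> quad_solutions m n. odd x \<and> odd y \<and> odd z \<and> odd w} = A"
    using quad_solutions_odd[OF assms(3)] unfolding A_def by blast
  hence t: "t [1, 1, 8, m] n = card A" by (simp only: t_eq_card_quad_solutions)
  let ?e = "\<lambda>(x :: int, y :: int, z, w :: int). eps z"
  \<comment> \<open>The vanishing signed sum says that solutions with odd \<open>z\<close> and with
    even \<open>z\<close> are equally many, so \<open>A\<close> is half of all solutions.\<close>
  have "0 = sum ?e (quad_solutions m n)" using sum_quad_solutions_eq_0 assms by metis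
  also have "\<dots> = sum ?e A + sum ?e B" unfolding AB(1) using fin AB(2) by (rule sum.union_disjoint)
  also have "sum ?e A = (\<Sum>x\<in>A. - 1)" by (rule sum.cong) (auto simp: A_def eps_def)
  also have "sum ?e B = (\<Sum>x\<in>B. 1)" by (rule sum.cong) (auto simp: B_def eps_def)
  finally have "card A = card B" by simp
  moreover have "card (quad_solutions m n) = card A + card B" unfolding AB(1) using fin AB(2) by (rule card_Un_disjoint)
  ultimately show ?thesis unfolding t N_eq_card_quad_solutions by simp
qed

end
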